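(* (1) The slim dense near hexagon $Q(5,2)\times\mathbb{L}_3$ has a non-abelian representation in the extra-special $2$-group $2^{1+12}_+$. (2) The slim dense near hexagon $Q(5,2)\otimes Q(5,2)$ has a non-abelian representation in the extra-special $2$-group $2^{1+18}_-$.
   Context: A partial linear space $\mathcal{S}=(P,L)$ is slim if every line has exactly three points. For collinear distinct points $x,y$, write $x*y$ for the third point of the line $xy$. A representation of a slim partial linear space $\mathcal{S}=(P,L)$ is a pair $(R,\psi)$ where $R$ is a group and $\psi$ maps $P$ into the set of involutions of $R$ such that (R1) $R$ is generated by $\psi(P)$, and (R2) for every line $\{x,y,x*y\}$, $\psi$ is injective on this line and $\psi(x)\psi(y)=\psi(x*y)$. The representation is non-abelian if $R$ is non-abelian. A near polygon is a partial linear space such that for every point $p$ and line $\ell$ there is a unique point on $\ell$ nearest to $p$ (distance in the collinearity graph); it is a near hexagon if the maximal distance between points is $3$. It is dense if every line has at least three points and any two points at distance $2$ have at least two common neighbours. $Q(5,2)$ denotes the (unique up to isomorphism) generalized quadrangle of order $(2,4)$, e.g. the points and lines of a nonsingular elliptic quadric in $\mathrm{PG}(5,2)$. $Q(5,2)\times\mathbb{L}_3$ is the geometry with point set $\{(x,i): x \text{ a point of } Q(5,2),\ i\in\{0,1,2\}\}$ whose lines are the sets $\{(x,i),(y,i),(z,i)\}$ with $\{x,y,z\}$ a line of $Q(5,2)$ and $i\in\{0,1,2\}$, and the sets $\{(x,0),(x,1),(x,2)\}$; it is the unique slim dense near hexagon on $81$ points. $Q(5,2)\otimes Q(5,2)$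 denotes the (up to isomorphism unique) slim dense near hexagon on $243$ points. A finite $2$-group $G$ is extra-special if its Frattini subgroup, commutator subgroup and center coincide and have order $2$; then $|G|=2^{1+2m}$, and $2^{1+2m}_+$ denotes the central product of $m$ copies of the dihedral group $D_8$, while $2^{1+2m}_-$ denotes the central product of $m-1$ copies of $D_8$ and one copy of the quaternion group $Q_8$. *)

theory Defs
  imports
    "HOL-Algebra.Generated_Groups"
    "HOL-Analysis.Finite_Cartesian_Product"
    "HOL-Library.Extended_Nat"
    "HOL-Library.Numeral_Type"
    "HOL-Library.Z2"
begin

subsection \<open>Point-line geometries and near polygons\<close>

type_synonym 'a geometry = "'a set \<times> 'a set set"

abbreviation points :: "'a geometry \<Rightarrow> 'a set" where "points \<equiv> fst"
abbreviation lines :: "'a geometry \<Rightarrow> 'a set set" where "lines \<equiv> snd"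

definition partial_linear_space :: "'a geometry \<Rightarrow> bool" where
  "partial_linear_space S \<longleftrightarrow>
     (\<forall>l\<in>lines S. l \<subseteq> points S \<and> (\<exists>x\<in>l. \<exists>y\<in>l. x \<noteq> y)) \<and>
     (\<forall>x y l l'. l \<in> lines S \<and> l' \<in> lines S \<and> x \<noteq> y \<and> {x, y} \<subseteq> l \<and> {x, y} \<subseteq> l' \<longrightarrow> l = l')"

definition slim :: "'a geometry \<Rightarrow> bool" where
  "slim S \<longleftrightarrow> (\<forall>l\<in>lines S. card l = 3)"

definition collinearity :: "'a geometry \<Rightarrow> 'a rel" where
  "collinearity S = {(x, y). x \<noteq> y \<and> (\<exists>l\<in>lines S. x \<in> l \<and> y \<in> l)}"

text \<open>Points in different components of the collinearity graph have distance \<open>\<infinity>\<close>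
  (the infimum of the empty set).\<close>

definition pdist :: "'a geometry \<Rightarrow> 'a \<Rightarrow> 'a \<Rightarrow> enat" where
  "pdist S x y = Inf {enat n | n. (x, y) \<in> collinearity S ^^ n}"

definition near_polygon :: "'a geometry \<Rightarrow> bool" where
  "near_polygon S \<longleftrightarrow> partial_linear_space S \<and>
     (\<forall>p\<in>points S. \<forall>l\<in>lines S. \<exists>!q. q \<in> l \<and> (\<forall>r\<in>l. pdist S p q \<le> pdist S p r))"

definition near_hexagon :: "'a geometry \<Rightarrow> bool" where
  "near_hexagon S \<longleftrightarrow> near_polygon S \<and>
     (\<forall>x\<in>points S. \<forall>y\<in>points S. pdist S x y \<le> 3) \<and>
     (\<exists>x\<in>points S. \<exists>y\<in>points S. pdist S x y = 3)"

definition dense :: "'a geometry \<Rightarrow> bool" where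
  "dense S \<longleftrightarrow>
     (\<forall>l\<in>lines S. infinite l \<or> 3 \<le> card l) \<and>
     (\<forall>x\<in>points S. \<forall>y\<in>points S. pdist S x y = 2 \<longrightarrow>
        (\<exists>a b. a \<noteq> b \<and> {(x, a), (a, y), (x, b), (b, y)} \<subseteq> collinearity S))"

definition slim_dense_near_hexagon :: "'a geometry \<Rightarrow> bool" where
  "slim_dense_near_hexagon S \<longleftrightarrow> slim S \<and> dense S \<and> near_hexagon S"


subsection \<open>Representations\<close>

definition involutions :: "('g, 'm) monoid_scheme \<Rightarrow> 'g set" where
  "involutions R = {g \<in> carrier R. g \<noteq> \<one>\<^bsub>R\<^esub> \<and> g \<otimes>\<^bsub>R\<^esub> g = \<one>\<^bsub>R\<^esub>}"

definition representation ::
    "'a geometry \<Rightarrow> ('g, 'm) monoid_scheme \<Rightarrow> ('a \<Rightarrow> 'g) \<Rightarrow> bool" where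
  "representation S R \<psi> \<longleftrightarrow>
     group R \<and> \<psi> ` points S \<subseteq> involutions R \<and>
     generate R (\<psi> ` points S) = carrier R \<and>
     (\<forall>x y z. distinct [x, y, z] \<and> {x, y, z} \<in> lines S \<longrightarrow>
        inj_on \<psi> {x, y, z} \<and> \<psi> x \<otimes>\<^bsub>R\<^esub> \<psi> y = \<psi> z)"

definition nonabelian_representation ::
    "'a geometry \<Rightarrow> ('g, 'm) monoid_scheme \<Rightarrow> ('a \<Rightarrow> 'g) \<Rightarrow> bool" where
  "nonabelian_representation S R \<psi> \<longleftrightarrow> representation S R \<psi> \<and> \<not> comm_group R"


subsection \<open>Extra-special 2-groups\<close>

definition center :: "('g, 'm) monoid_scheme \<Rightarrow> 'g set" where
  "center G = {z \<in> carrier G. \<forall>g\<in>carrier G. z \<otimes>\<^bsub>G\<^esub> g = g \<otimes>\<^bsub>G\<^esub> z}"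

definition maximal_subgroup :: "'g set \<Rightarrow> ('g, 'm) monoid_scheme \<Rightarrow> bool" where
  "maximal_subgroup M G \<longleftrightarrow> subgroup M G \<and> M \<noteq> carrier G \<and>
     (\<forall>H. subgroup H G \<and> M \<subseteq> H \<longrightarrow> H = M \<or> H = carrier G)"

definition frattini :: "('g, 'm) monoid_scheme \<Rightarrow> 'g set" where
  "frattini G = carrier G \<inter> \<Inter>{M. maximal_subgroup M G}"

definition extra_special_2_group :: "('g, 'm) monoid_scheme \<Rightarrow> bool" where
  "extra_special_2_group G \<longleftrightarrow>
     group G \<and> (\<exists>n. order G = 2 ^ n) \<and>
     frattini G = center G \<and> derived G (carrier G) = center G \<and> card (center G) = 2"

text \<open>In both groups the pair \<open>(i, a)\<close> stands for \<open>r\<^sup>i s\<^sup>a\<close>, where \<open>r\<close> has order 4 and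
  \<open>s r s\<^sup>-\<^sup>1 = r\<^sup>-\<^sup>1\<close>; in \<open>D8\<close> one has \<open>s\<^sup>2 = 1\<close>, in \<open>Q8\<close> one has \<open>s\<^sup>2 = r\<^sup>2\<close>.\<close>

definition D8 :: "(int \<times> bool) monoid" where
  "D8 = \<lparr>carrier = {0..<4} \<times> UNIV,
         mult = (\<lambda>(i, a) (j, b). ((i + (if a then - j else j)) mod 4, a \<noteq> b)),
         one = (0, False)\<rparr>"

definition Q8 :: "(int \<times> bool) monoid" where
  "Q8 = \<lparr>carrier = {0..<4} \<times> UNIV,
         mult = (\<lambda>(i, a) (j, b).
           ((i + (if a then - j else j) + (if a \<and> b then 2 else 0)) mod 4, a \<noteq> b)),
         one = (0, False)\<rparr>"

definition central_product :: "('g, 'm) monoid_scheme \<Rightarrow> 'i set \<Rightarrow> ('i \<Rightarrow> 'g set) \<Rightarrow> bool" where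
  "central_product G I H \<longleftrightarrow>
     group G \<and> (\<forall>i\<in>I. subgroup (H i) G) \<and>
     (\<forall>i\<in>I. \<forall>j\<in>I. i \<noteq> j \<longrightarrow> (\<forall>g\<in>H i. \<forall>h\<in>H j. g \<otimes>\<^bsub>G\<^esub> h = h \<otimes>\<^bsub>G\<^esub> g)) \<and>
     generate G (\<Union>i\<in>I. H i) = carrier G"

text \<open>Since the centre of an extra-special group has order 2, the centres of the factors below
  are all identified with it; these conditions determine \<open>G\<close> up to isomorphism.\<close>

definition extra_special_plus :: "nat \<Rightarrow> ('g, 'm) monoid_scheme \<Rightarrow> bool" where
  "extra_special_plus m G \<longleftrightarrow>
     extra_special_2_group G \<and> order G = 2 ^ (1 + 2 * m) \<and>
     (\<exists>H. central_product G {..<m} H \<and> (\<forall>i<m. G\<lparr>carrier := H i\<rparr> \<cong> D8))"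

definition extra_special_minus :: "nat \<Rightarrow> ('g, 'm) monoid_scheme \<Rightarrow> bool" where
  "extra_special_minus m G \<longleftrightarrow>
     extra_special_2_group G \<and> order G = 2 ^ (1 + 2 * m) \<and>
     (\<exists>H. central_product G {..<m} H \<and>
          (\<forall>i<m. G\<lparr>carrier := H i\<rparr> \<cong> (if i = 0 then Q8 else D8)))"


subsection \<open>The near hexagons\<close>

text \<open>The points of \<open>PG(5,2)\<close> are the nonzero vectors of \<open>GF(2)\<^sup>6\<close> and its lines the sets
  \<open>{x, y, x + y}\<close>. The form \<open>X\<^sup>2 + X Y + Y\<^sup>2\<close> is anisotropic over \<open>GF(2)\<close>, so the quadric below
  is nonsingular and elliptic.\<close>

definition elliptic_form :: "bit ^ 6 \<Rightarrow> bit" where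
  "elliptic_form x = x $ 0 * x $ 1 + x $ 2 * x $ 3 + (x $ 4)\<^sup>2 + x $ 4 * x $ 5 + (x $ 5)\<^sup>2"

definition Q52_points :: "(bit ^ 6) set" where
  "Q52_points = {x. x \<noteq> 0 \<and> elliptic_form x = 0}"

definition Q52 :: "(bit ^ 6) geometry" where
  "Q52 = (Q52_points, {{x, y, x + y} | x y. x \<noteq> y \<and> {x, y, x + y} \<subseteq> Q52_points})"

definition times_L3 :: "'a geometry \<Rightarrow> ('a \<times> nat) geometry" where
  "times_L3 S = (points S \<times> {0, 1, 2},
     {l \<times> {i} | l i. l \<in> lines S \<and> i \<in> {0, 1, 2}} \<union> {{x} \<times> {0, 1, 2} | x. x \<in> points S})"

text \<open>With the symplectic form \<open>\<Delta>\<close> on \<open>GF(3)\<^sup>2\<close>, the points \<open>(i, u) \<in> GF(3) \<times> GF(3)\<^sup>2\<close>, the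
  fibres \<open>{(i, u) | i}\<close> and the sets \<open>{(i + k \<Delta>(u, d), u + k d) | k}\<close> for \<open>d \<noteq> 0\<close> form a
  generalized quadrangle of order \<open>(2,4)\<close>, hence a copy of \<open>Q(5,2)\<close>, in which the fibres are a
  spread of symmetry: \<open>(i, u)\<close> and \<open>(j, v)\<close> with \<open>u \<noteq> v\<close> are collinear iff
  \<open>j = i + \<Delta>(u, v)\<close>. The geometry \<open>Q52_glued_Q52\<close> glues two such copies along these
  spreads: fixing \<open>v\<close>, or fixing \<open>u\<close>, in \<open>(i, u, v)\<close> yields a copy of \<open>Q(5,2)\<close>, and two such
  subquadrangles of different kinds share a fibre.\<close>

definition symp :: "3 ^ 2 \<Rightarrow> 3 ^ 2 \<Rightarrow> 3" (\<open>\<Delta>\<close>) where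
  "\<Delta> u v = u $ 0 * v $ 1 - u $ 1 * v $ 0"

definition Q52_glued_Q52 :: "(3 \<times> (3 ^ 2) \<times> (3 ^ 2)) geometry" where
  "Q52_glued_Q52 = (UNIV,
     {range (\<lambda>k. (k, u, v)) | u v. True} \<union>
     {range (\<lambda>k. (i + k * \<Delta> u d, u + k *s d, v)) | i u v d. d \<noteq> 0} \<union>
     {range (\<lambda>k. (i + k * \<Delta> v d, u, v + k *s d)) | i u v d. d \<noteq> 0})"

end

theory Submission
  imports Defs "HOL-Combinatorics.Transposition"
begin

text \<open>For a bilinear form \<open>\<beta>\<close> on a \<open>GF(2)\<close>-space \<open>V\<close>, the product
  \<open>(s, x) (t, y) = (s + t + \<beta>(x, y), x + y)\<close> makes \<open>GF(2) \<times> V\<close> a group with squaring map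
  \<open>\<beta>(x, x)\<close> and commutator form \<open>\<beta>(x, y) + \<beta>(y, x)\<close>. It is extra-special if the commutator form
  is nondegenerate, and its type is that of the quadratic form \<open>\<beta>(x, x)\<close>. A map \<open>\<phi>\<close> from points
  to nonzero vectors gives a representation \<open>p \<mapsto> (0, \<phi> p)\<close> as soon as its image spans \<open>V\<close>, lines
  sum to zero, and \<open>\<beta>\<close> vanishes on pairs of points of a line.

  For \<open>Q(5,2) \<times> L\<^sub>3\<close> take \<open>V = GF(2)\<^sup>6 \<times> GF(2)\<^sup>6\<close> and \<open>\<beta>((p, q), (p', q')) = f(p, q')\<close>, where \<open>f\<close> is the
  polar form of the quadric, and send \<open>(x, 0), (x, 1), (x, 2)\<close> to \<open>(x, 0), (0, x), (x, x)\<close>.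

  For the glued hexagon, \<open>Q(5,2)\<close> with its spread of symmetry is \<open>\<omega>\<^sup>i w(u)\<close> in \<open>GF(4)\<^sup>3\<close>, where \<open>w(u)\<close>
  runs through the nine points of a Hermitian curve. The point \<open>(i, u, v)\<close> goes to
  \<open>\<omega>\<^sup>i w(u) \<otimes> w(v)\<close> in \<open>GF(4)\<^sup>9\<close>, and \<open>\<beta> = Tr(\<omega> (h \<otimes> h))\<close> for the Hermitian form \<open>h\<close>. It vanishes on
  points of a line because these share a tensor factor, which is isotropic; as 9 is odd, the
  Hermitian form on \<open>GF(4)\<^sup>9\<close> has minus type over \<open>GF(2)\<close>.\<close>

section \<open>Extra-special groups from bilinear forms over \<open>GF(2)\<close>\<close>

lemma UNIV_bit: "(UNIV :: bit set) = {0, 1}"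
  by auto

instance bit :: finite
  by standard (simp add: UNIV_bit)

lemma CARD_bit: "CARD(bit) = 2"
  using UNIV_bit by (metis card_2_iff zero_neq_one)

text \<open>The injection \<open>e\<close> transports the group to an arbitrary type, later
  \<open>nat\<close>. \<open>add_self\<close> makes \<open>'v\<close> a GF(2)-space; nondegeneracy
  is asked of the commutator form, not of \<open>\<beta>\<close> itself.\<close>

locale bilinear_group =
  fixes \<beta> :: "'v::{ab_group_add,finite} \<Rightarrow> 'v \<Rightarrow> bit" and e :: "bit \<times> 'v \<Rightarrow> 'g"
  assumes add_left: "\<beta> (x + y) z = \<beta> x z + \<beta> y z"
    and add_right: "\<beta> x (y + z) = \<beta> x y + \<beta> x z"
    and add_self: "(x::'v) + x = 0"
    and nondegenerate: "x \<noteq> 0 \<Longrightarrow> \<exists>y. \<beta> x y \<noteq> \<beta> y x"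
    and nontrivial: "\<exists>x::'v. x \<noteq> 0"
    and inj_e: "inj e"
begin

definition G :: "'g monoid" where
  "G = \<lparr>carrier = range e,
        mult = (\<lambda>g h. case (the_inv e g, the_inv e h) of ((s, x), (t, y)) \<Rightarrow> e (s + t + \<beta> x y, x + y)),
        one = e (0, 0)\<rparr>"

lemma carrier_G: "carrier G = range e"
  and one_G: "\<one>\<^bsub>G\<^esub> = e (0, 0)"
  and mult_G: "e (s, x) \<otimes>\<^bsub>G\<^esub> e (t, y) = e (s + t + \<beta> x y, x + y)"
  using inj_e by (simp_all add: G_def the_inv_f_f)

lemma e_eq_iff: "e p = e q \<longleftrightarrow> p = q"
  using inj_e by (auto dest: injD)

lemma zero_left: "\<beta> 0 x = 0"
  using add_left[of 0 0 x] by simp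

lemma zero_right: "\<beta> x 0 = 0"
  using add_right[of x 0 0] by simp

lemma add_left_self: "(x::'v) + (x + y) = y"
  using add_self[of x] by (metis add.assoc add_0)

lemma in_carrierE:
  assumes "g \<in> carrier G"
  obtains s x where "g = e (s, x)"
  using assms by (auto simp: carrier_G)

lemma e_in_carrier: "e p \<in> carrier G"
  by (simp add: carrier_G)

lemma group_G: "group G"
proof (rule groupI)
  show "\<one>\<^bsub>G\<^esub> \<in> carrier G"
    by (simp add: one_G e_in_carrier)
next
  fix g h assume "g \<in> carrier G" "h \<in> carrier G"
  then show "g \<otimes>\<^bsub>G\<^esub> h \<in> carrier G"
    by (auto elim!: in_carrierE simp: mult_G e_in_carrier)
next
  fix g h k assume "g \<in> carrier G" "h \<in> carrier G" "k \<in> carrier G"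
  then show "g \<otimes>\<^bsub>G\<^esub> h \<otimes>\<^bsub>G\<^esub> k = g \<otimes>\<^bsub>G\<^esub> (h \<otimes>\<^bsub>G\<^esub> k)"
    by (auto elim!: in_carrierE simp: mult_G add_left add_right e_eq_iff ac_simps)
next
  fix g assume "g \<in> carrier G"
  then show "\<one>\<^bsub>G\<^esub> \<otimes>\<^bsub>G\<^esub> g = g"
    by (auto elim!: in_carrierE simp: mult_G one_G zero_left)
next
  fix g assume "g \<in> carrier G"
  then obtain s x where g: "g = e (s, x)"
    by (rule in_carrierE)
  have "e (s + \<beta> x x, x) \<otimes>\<^bsub>G\<^esub> g = \<one>\<^bsub>G\<^esub>"
    by (simp add: g mult_G one_G e_eq_iff add_self) (cases s; cases "\<beta> x x"; simp)
  then show "\<exists>h\<in>carrier G. h \<otimes>\<^bsub>G\<^esub> g = \<one>\<^bsub>G\<^esub>"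
    using e_in_carrier by blast
qed

sublocale G: group G
  by (rule group_G)

lemma inv_G: "inv\<^bsub>G\<^esub> e (s, x) = e (s + \<beta> x x, x)"
  by (rule G.inv_equality; simp add: mult_G one_G e_eq_iff add_self e_in_carrier)
    (cases s; cases "\<beta> x x"; simp)

lemma commute_iff:
  "e (s, x) \<otimes>\<^bsub>G\<^esub> e (t, y) = e (t, y) \<otimes>\<^bsub>G\<^esub> e (s, x) \<longleftrightarrow> \<beta> x y = \<beta> y x"
  by (auto simp: mult_G e_eq_iff ac_simps)

lemma commutator_G:
  "e (s, x) \<otimes>\<^bsub>G\<^esub> e (t, y) \<otimes>\<^bsub>G\<^esub> inv\<^bsub>G\<^esub> e (s, x) \<otimes>\<^bsub>G\<^esub> inv\<^bsub>G\<^esub> e (t, y) =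
    e (\<beta> x y + \<beta> y x, 0)"
proof -
  have "x + y + x + y = 0"
    using add_self[of "x + y"] by (simp add: ac_simps)
  moreover have "s + t + \<beta> x y + (s + \<beta> x x) + \<beta> (x + y) x + (t + \<beta> y y) + \<beta> (x + y + x) y =
      \<beta> x y + \<beta> y x"
    by (simp add: add_left add_right)
      (cases s; cases t; cases "\<beta> x y"; cases "\<beta> y x"; cases "\<beta> x x"; cases "\<beta> y y"; simp)
  ultimately show ?thesis
    by (simp add: inv_G mult_G)
qed

section \<open>Order, centre, derived subgroup and Frattini subgroup\<close>

lemma order_G: "order G = 2 * CARD('v)"
  unfolding order_def carrier_G by (simp add: card_image[OF inj_e] CARD_bit)

lemma center_G: "center G = e ` (UNIV \<times> {0})"
proof -
  have "x = 0" if "\<And>g. g \<in> carrier G \<Longrightarrow> e (s, x) \<otimes>\<^bsub>G\<^esub> g = g \<otimes>\<^bsub>G\<^esub> e (s, x)" for s x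
    using nondegenerate[of x] that[OF e_in_carrier] commute_iff by (metis surj_pair)
  moreover have "e (s, 0) \<otimes>\<^bsub>G\<^esub> g = g \<otimes>\<^bsub>G\<^esub> e (s, 0)" if "g \<in> carrier G" for s g
    using that by (auto elim!: in_carrierE simp: commute_iff zero_left zero_right)
  ultimately show ?thesis
    unfolding center_def by (fastforce simp: e_in_carrier elim!: in_carrierE)
qed

lemma card_center_G: "card (center G) = 2"
  unfolding center_G
  by (subst card_image[OF inj_on_subset[OF inj_e]]) (simp_all add: card_cartesian_product CARD_bit)

lemma ex_noncommuting: "\<exists>x y. \<beta> x y \<noteq> \<beta> y x"
  using nontrivial nondegenerate by blast

text \<open>A subgroup that covers the elementary abelian quotient contains two non-commuting elements,
  hence their commutator, which is the central involution.\<close>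

lemma subgroup_eq_carrier:
  assumes K: "subgroup K G" and cover: "\<And>x. \<exists>s. e (s, x) \<in> K"
  shows "K = carrier G"
proof
  show "K \<subseteq> carrier G"
    using K by (rule subgroup.subset)
  obtain x y where xy: "\<beta> x y \<noteq> \<beta> y x"
    using ex_noncommuting by blast
  obtain s t where "e (s, x) \<in> K" "e (t, y) \<in> K"
    using cover by blast
  then have "e (\<beta> x y + \<beta> y x, 0) \<in> K"
    using K by (metis commutator_G subgroup.m_closed subgroup.m_inv_closed)
  moreover have "\<beta> x y + \<beta> y x = 1"
    using xy by (cases "\<beta> x y"; cases "\<beta> y x") auto
  ultimately have z: "e (1, 0) \<in> K"
    by simp
  have "e (s, x) \<in> K" for s x
  proof -
    obtain t where t: "e (t, x) \<in> K"
      using cover by blast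
    with z K have "e (1, 0) \<otimes>\<^bsub>G\<^esub> e (t, x) \<in> K"
      by (simp add: subgroup.m_closed)
    then have "e (1 + t, x) \<in> K"
      by (simp add: mult_G zero_left)
    with t show ?thesis
      by (cases s; cases t) auto
  qed
  then show "carrier G \<subseteq> K"
    by (auto elim!: in_carrierE)
qed

text \<open>Over GF(2) a span is an additive closure. The projection of the generated subgroup to
  \<open>'v\<close> is closed in this sense, so it is everything, and
  \<open>subgroup_eq_carrier\<close> supplies the centre.\<close>

lemma generate_eq_carrier:
  assumes X: "X \<subseteq> carrier G"
    and span: "\<And>S. (\<And>s x. e (s, x) \<in> X \<Longrightarrow> x \<in> S) \<Longrightarrow> 0 \<in> S \<Longrightarrow>
      (\<And>x y. x \<in> S \<Longrightarrow> y \<in> S \<Longrightarrow> x + y \<in> S) \<Longrightarrow> S = UNIV"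
  shows "generate G X = carrier G"
proof (rule subgroup_eq_carrier)
  show K: "subgroup (generate G X) G"
    using X by (rule G.generate_is_subgroup)
  define S where "S = {x. \<exists>s. e (s, x) \<in> generate G X}"
  have "S = UNIV"
  proof (rule span)
    show "x \<in> S" if "e (s, x) \<in> X" for s x
      using that by (auto simp: S_def intro: generate.incl)
    show "0 \<in> S"
      using generate.one[of G X] by (auto simp: S_def one_G)
    show "x + y \<in> S" if xy: "x \<in> S" "y \<in> S" for x y
    proof -
      obtain s t where "e (s, x) \<in> generate G X" "e (t, y) \<in> generate G X"
        using xy unfolding S_def by blast
      then have "e (s, x) \<otimes>\<^bsub>G\<^esub> e (t, y) \<in> generate G X"
        by (rule generate.eng)
      then show ?thesis
        by (auto simp: S_def mult_G)
    qed
  qed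
  then show "\<exists>s. e (s, x) \<in> generate G X" for x
    by (auto simp: S_def)
qed

text \<open>By \<open>commutator_G\<close> all commutators are central, and a non-commuting pair
  realises the central involution, so the commutators already form the subgroup.\<close>

lemma derived_G: "derived G (carrier G) = center G"
proof -
  have D: "derived_set G (carrier G) = e ` (UNIV \<times> {0})"
  proof
    show "derived_set G (carrier G) \<subseteq> e ` (UNIV \<times> {0})"
      by (auto elim!: in_carrierE simp: commutator_G)
    have "e (s, 0) \<in> derived_set G (carrier G)" for s
    proof -
      obtain x y where xy: "\<beta> x y \<noteq> \<beta> y x"
        using ex_noncommuting by blast
      have "\<exists>x' y'. e (s, 0) = e (\<beta> x' y' + \<beta> y' x', 0)"
      proof (cases s)
        case zero
        then show ?thesis
          by (auto simp: e_eq_iff zero_left intro!: exI[of _ 0])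
      next
        case one
        then show ?thesis
          using xy by (intro exI[of _ x] exI[of _ y]) (cases "\<beta> x y"; cases "\<beta> y x"; simp)
      qed
      then obtain x' y' where
        "e (s, 0) = e (0, x') \<otimes>\<^bsub>G\<^esub> e (0, y') \<otimes>\<^bsub>G\<^esub> inv\<^bsub>G\<^esub> e (0, x') \<otimes>\<^bsub>G\<^esub> inv\<^bsub>G\<^esub> e (0, y')"
        by (auto simp: commutator_G)
      then show ?thesis
        using e_in_carrier by blast
    qed
    then show "e ` (UNIV \<times> {0}) \<subseteq> derived_set G (carrier G)"
      by auto
  qed
  have "subgroup (e ` (UNIV \<times> {0})) G"
  proof (rule G.subgroupI)
    show "e ` (UNIV \<times> {0}) \<subseteq> carrier G"
      by (auto simp: e_in_carrier)
  qed (auto simp: inv_G mult_G zero_left)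
  then show ?thesis
    unfolding derived_def D center_G
    by (simp add: G.generateI generate.incl subset_antisym G.generate_subgroup_incl subsetI)
qed

lemma subgroup_of_subspace:
  assumes "0 \<in> P" "\<And>x y. x \<in> P \<Longrightarrow> y \<in> P \<Longrightarrow> x + y \<in> P"
  shows "subgroup (e ` (UNIV \<times> P)) G"
proof (rule G.subgroupI)
  show "e ` (UNIV \<times> P) \<subseteq> carrier G"
    by (auto simp: e_in_carrier)
qed (use assms in \<open>auto simp: inv_G mult_G\<close>)

text \<open>A noncentral element is avoided by some centralizer of index 2. Conversely, the full
  preimage of the projection of a maximal \<open>M\<close> is either \<open>M\<close>, which then
  contains the centre, or everything, and then \<open>subgroup_eq_carrier\<close> contradicts
  maximality.\<close>

lemma frattini_G: "frattini G = center G"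
proof
  show "frattini G \<subseteq> center G"
  proof
    fix g assume g: "g \<in> frattini G"
    then obtain s x where sx: "g = e (s, x)"
      by (auto simp: frattini_def elim: in_carrierE)
    have "x = 0"
    proof (rule ccontr)
      assume "x \<noteq> 0"
      then obtain w where w: "\<beta> x w \<noteq> \<beta> w x"
        using nondegenerate by blast
      define P where "P = {y. \<beta> y w = \<beta> w y}"
      \<comment> \<open>The centralizer of \<open>e (0, w)\<close> has index 2.\<close>
      define M where "M = e ` (UNIV \<times> P)"
      have M: "subgroup M G"
        unfolding M_def
        by (rule subgroup_of_subspace) (auto simp: P_def zero_left zero_right add_left add_right)
      have "maximal_subgroup M G"
        unfolding maximal_subgroup_def
      proof (intro conjI allI impI M)
        show "M \<noteq> carrier G"
        proof
          assume "M = carrier G"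
          then have "e (0, x) \<in> M"
            by (simp add: e_in_carrier)
          then show False
            using w by (auto simp: M_def P_def e_eq_iff)
        qed
        fix H assume H: "subgroup H G \<and> M \<subseteq> H"
        show "H = M \<or> H = carrier G"
        proof (cases "H \<subseteq> M")
          case False
          then obtain h where h: "h \<in> H" "h \<notin> M"
            by blast
          then obtain t y where ty: "h = e (t, y)"
            using H subgroup.subset in_carrierE by (metis subsetD)
          then have y: "y \<notin> P"
            using h by (auto simp: M_def)
          have "e (r, v) \<in> H" for r v
          proof (cases "v \<in> P")
            case True
            then show ?thesis
              using H by (auto simp: M_def)
          next
            case False
            then have "y + v \<in> P"
              using y by (simp add: P_def add_left add_right)
                (cases "\<beta> y w"; cases "\<beta> w y"; cases "\<beta> v w"; cases "\<beta> w v"; simp)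
            \<comment> \<open>The first coordinate is chosen so that multiplying by \<open>h\<close>
              gives exactly \<open>e (r, v)\<close>.\<close>
            then have "e (r + t + \<beta> y (y + v), y + v) \<in> H"
              using H by (auto simp: M_def)
            then have "h \<otimes>\<^bsub>G\<^esub> e (r + t + \<beta> y (y + v), y + v) \<in> H"
              using h H by (simp add: subgroup.m_closed)
            moreover have "h \<otimes>\<^bsub>G\<^esub> e (r + t + \<beta> y (y + v), y + v) = e (r, v)"
              by (simp add: ty mult_G e_eq_iff add_left_self)
                (cases r; cases t; cases "\<beta> y (y + v)"; simp)
            ultimately show ?thesis
              by simp
          qed
          then have "H = carrier G"
            using H subgroup.subset[of H G] by (auto elim!: in_carrierE)
          then show ?thesis ..
        qed (use H in blast)
      qed
      then have "g \<in> M"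
        using g by (auto simp: frattini_def)
      then show False
        using w by (auto simp: sx M_def P_def e_eq_iff)
    qed
    then show "g \<in> center G"
      by (simp add: sx center_G)
  qed
next
  have "center G \<subseteq> M" if M: "maximal_subgroup M G" for M
  proof -
    define P where "P = {x. \<exists>s. e (s, x) \<in> M}"
    have sub: "subgroup M G"
      using M by (simp add: maximal_subgroup_def)
    have "subgroup (e ` (UNIV \<times> P)) G"
    proof (rule subgroup_of_subspace)
      show "0 \<in> P"
        using subgroup.one_closed[OF sub] by (auto simp: P_def one_G)
      show "x + y \<in> P" if "x \<in> P" "y \<in> P" for x y
        using that subgroup.m_closed[OF sub] unfolding P_def by (force simp: mult_G)
    qed
    moreover have "M \<subseteq> e ` (UNIV \<times> P)"
      using subgroup.subset[OF sub] by (force simp: P_def carrier_G)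
    ultimately have "e ` (UNIV \<times> P) = M \<or> e ` (UNIV \<times> P) = carrier G"
      using M by (auto simp: maximal_subgroup_def)
    then show ?thesis
    proof
      assume "e ` (UNIV \<times> P) = M"
      moreover have "0 \<in> P"
        using subgroup.one_closed[OF sub] by (auto simp: P_def one_G)
      ultimately show ?thesis
        by (auto simp: center_G)
    next
      assume *: "e ` (UNIV \<times> P) = carrier G"
      have "\<exists>s. e (s, x) \<in> M" for x
        using e_in_carrier[of "(0, x)"] by (auto simp flip: * simp: P_def e_eq_iff)
      with sub have "M = carrier G"
        by (rule subgroup_eq_carrier)
      with M show ?thesis
        by (simp add: maximal_subgroup_def)
    qed
  qed
  then show "center G \<subseteq> frattini G"
    by (auto simp: frattini_def center_def)
qed

lemma extra_special_G:
  assumes "CARD('v) = 2 ^ n"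
  shows "extra_special_2_group G"
  unfolding extra_special_2_group_def
  using group_G frattini_G derived_G card_center_G order_G assms by (auto intro!: exI[of _ "Suc n"])

lemma not_comm_group_G: "\<not> comm_group G"
proof
  assume "comm_group G"
  then interpret comm_group G .
  obtain x y where "\<beta> x y \<noteq> \<beta> y x"
    using ex_noncommuting by blast
  then show False
    using m_comm[OF e_in_carrier e_in_carrier] commute_iff by blast
qed

section \<open>Subgroups over two-dimensional subspaces and their central product\<close>

definition plane :: "'v \<Rightarrow> 'v \<Rightarrow> 'g set" where
  "plane a b = e ` (UNIV \<times> {0, a, b, a + b})"

lemma subgroup_plane: "subgroup (plane a b) G"
  unfolding plane_def
  by (rule subgroup_of_subspace) (auto simp: add_self add_left_self add.commute add.left_commute)

text \<open>One table serves both models. Here \<open>f (i, u)\<close> is r^i s^u with r =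
  \<open>e (0, a)\<close> \<open>e (0, b)\<close> and s = \<open>e (0, a)\<close>: r^2 is the
  central involution because \<open>\<beta> a b\<close> and \<open>\<beta> b a\<close> differ, and
  s^2 = \<open>e (c, 0)\<close>, so \<open>c = 1\<close> gives the quaternion relation s^2 =
  r^2.\<close>

lemma plane_table:
  fixes f :: "int \<times> bool \<Rightarrow> 'g"
  assumes f: "f (0, False) = e (0, 0)" "f (1, False) = e (d, a + b)"
    "f (2, False) = e (1, 0)" "f (3, False) = e (d + 1, a + b)"
    "f (0, True) = e (0, a)" "f (1, True) = e (c + 1, b)" "f (2, True) = e (1, a)"
    "f (3, True) = e (c, b)"
    and ab: "\<beta> a b = d" "\<beta> b a = d + 1" "\<beta> a a = c" "\<beta> b b = c"
    and i: "i \<in> {0, 1, 2, 3}" and j: "j \<in> {0, 1, 2, 3}"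
  shows "f ((i + (if u then - j else j) + (if u \<and> v \<and> c = 1 then 2 else 0)) mod 4, u \<noteq> v) =
    f (i, u) \<otimes>\<^bsub>G\<^esub> f (j, v)"
proof -
  have "b + a = a + b" "a + a = 0" "b + b = 0" "a + b + a = b" "a + b + b = a"
    "a + (a + b) = b" "b + (a + b) = a" "a + b + (a + b) = 0"
    using add_self add_left_self by (metis add.commute)+
  note table = this mult_G zero_left zero_right add_left add_right
  consider "c = 0" "d = 0" | "c = 0" "d = 1" | "c = 1" "d = 0" | "c = 1" "d = 1"
    by (cases c; cases d) auto
  then show ?thesis
  proof cases
    case 1
    note vals = f[unfolded 1] ab[unfolded 1]
    from i j show ?thesis
      by (elim insertE emptyE; cases u; cases v) (simp_all add: vals table 1)
  next
    case 2
    note vals = f[unfolded 2] ab[unfolded 2]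
    from i j show ?thesis
      by (elim insertE emptyE; cases u; cases v) (simp_all add: vals table 2)
  next
    case 3
    note vals = f[unfolded 3] ab[unfolded 3]
    from i j show ?thesis
      by (elim insertE emptyE; cases u; cases v) (simp_all add: vals table 3)
  next
    case 4
    note vals = f[unfolded 4] ab[unfolded 4]
    from i j show ?thesis
      by (elim insertE emptyE; cases u; cases v) (simp_all add: vals table 4)
  qed
qed

lemma plane_iso:
  assumes nc: "\<beta> a b \<noteq> \<beta> b a" and q: "\<beta> a a = c" "\<beta> b b = c"
  shows "G\<lparr>carrier := plane a b\<rparr> \<cong> (if c = 0 then D8 else Q8)"
proof -
  define d where "d = \<beta> a b"
  let ?H = "if c = 0 then D8 else Q8"
  have carr: "carrier ?H = {0, 1, 2, 3} \<times> UNIV"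
    by (auto simp: D8_def Q8_def)
  have distinct: "a \<noteq> 0" "b \<noteq> 0" "a \<noteq> b" "a + b \<noteq> 0" "a + b \<noteq> a" "a + b \<noteq> b"
    using nc zero_left zero_right add_left_self[of a b] by (auto, metis add.right_neutral)
  have ba: "\<beta> b a = d + 1"
    using nc by (cases "\<beta> a b"; cases "\<beta> b a") (auto simp: d_def)
  \<comment> \<open>\<open>(i, u)\<close> goes to \<open>r\<^sup>i s\<^sup>u\<close> with \<open>r = e (0, a) e (0, b)\<close> and \<open>s = e (0, a)\<close>.\<close>
  define f where "f = (\<lambda>(i :: int, u).
     if u then (if i = 0 then e (0, a) else if i = 1 then e (c + 1, b)
                else if i = 2 then e (1, a) else e (c, b))
     else (if i = 0 then e (0, 0) else if i = 1 then e (d, a + b)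
                else if i = 2 then e (1, 0) else e (d + 1, a + b)))"
  have f: "f (0, False) = e (0, 0)" "f (1, False) = e (d, a + b)"
    "f (2, False) = e (1, 0)" "f (3, False) = e (d + 1, a + b)"
    "f (0, True) = e (0, a)" "f (1, True) = e (c + 1, b)" "f (2, True) = e (1, a)"
    "f (3, True) = e (c, b)"
    by (simp_all add: f_def)
  have f_mult: "f (p \<otimes>\<^bsub>?H\<^esub> p') = f p \<otimes>\<^bsub>G\<^esub> f p'"
    if p: "p \<in> carrier ?H" and p': "p' \<in> carrier ?H" for p p'
  proof -
    obtain i u j v where ij: "p = (i, u)" "p' = (j, v)" "i \<in> {0, 1, 2, 3}" "j \<in> {0, 1, 2, 3}"
      using p p' unfolding carr by auto
    show ?thesis
      using plane_table[OF f d_def[symmetric] ba q ij(3,4), of u v]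
      by (cases c) (simp_all add: ij(1,2) D8_def Q8_def)
  qed
  have "e (t, x) \<in> f ` carrier ?H" if "x \<in> {0, a, b, a + b}" for t x
  proof -
    have "f (i, u) \<in> f ` carrier ?H" if "i \<in> {0, 1, 2, 3}" for i u
      using \<open>i \<in> {0, 1, 2, 3}\<close> unfolding carr by blast
    then have "f (0, u) \<in> f ` carrier ?H" "f (1, u) \<in> f ` carrier ?H"
       "f (2, u) \<in> f ` carrier ?H" "f (3, u) \<in> f ` carrier ?H" for u
      by simp_all
    note this[of True] this[of False]
    note mem = this[unfolded f]
    have "t = 0 \<or> t = 1" "t = c \<or> t = c + 1" "t = d \<or> t = d + 1"
      by (cases t; cases c; cases d; simp)+
    moreover have "x = 0 \<or> x = a \<or> x = b \<or> x = a + b"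
      using that by simp
    ultimately show ?thesis
      using mem by metis
  qed
  then have "plane a b \<subseteq> f ` carrier ?H"
    by (auto simp only: plane_def)
  moreover have "f ` carrier ?H \<subseteq> plane a b"
    by (auto simp: f_def plane_def)
  ultimately have im: "f ` carrier ?H = plane a b"
    by blast
  \<comment> \<open>Injectivity follows by counting: \<open>f\<close> maps eight elements onto
    eight.\<close>
  have "card (plane a b) = 8"
    unfolding plane_def using distinct
    by (subst card_image[OF inj_on_subset[OF inj_e]])
      (simp_all add: card_cartesian_product CARD_bit card_insert_if)
  moreover have "card (carrier ?H) = 8"
    unfolding carr by (simp add: card_cartesian_product)
  ultimately have "inj_on f (carrier ?H)"
    by (intro eq_card_imp_inj_on) (simp_all only: im, simp add: carr)
  with im have bij: "bij_betw f (carrier ?H) (plane a b)"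
    by (simp only: bij_betw_def)
  have carr_plane: "carrier (G\<lparr>carrier := plane a b\<rparr>) = plane a b"
    by simp
  \<comment> \<open>The isomorphism is wanted from the plane to the model, opposite to
    \<open>f\<close>.\<close>
  define g where "g = inv_into (carrier ?H) f"
  have "g \<in> hom (G\<lparr>carrier := plane a b\<rparr>) ?H"
  proof (rule homI)
    show "g x \<in> carrier ?H" if "x \<in> carrier (G\<lparr>carrier := plane a b\<rparr>)" for x
      using bij_betw_apply[OF bij_betw_inv_into[OF bij]] that unfolding carr_plane g_def .
  next
    fix x y assume "x \<in> carrier (G\<lparr>carrier := plane a b\<rparr>)" "y \<in> carrier (G\<lparr>carrier := plane a b\<rparr>)"
    then have "x \<in> f ` carrier ?H" "y \<in> f ` carrier ?H"
      unfolding im carr_plane .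
    then obtain p p' where p: "p \<in> carrier ?H" "x = f p" and p': "p' \<in> carrier ?H" "y = f p'"
      by blast
    have "p \<otimes>\<^bsub>?H\<^esub> p' \<in> carrier ?H"
      by (auto simp: D8_def Q8_def split: prod.splits)
    then have "g (f (p \<otimes>\<^bsub>?H\<^esub> p')) = p \<otimes>\<^bsub>?H\<^esub> p'" "g (f p) = p" "g (f p') = p'"
      using bij_betw_inv_into_left[OF bij] p p' by (simp_all only: g_def)
    then show "g (x \<otimes>\<^bsub>G\<lparr>carrier := plane a b\<rparr>\<^esub> y) = g x \<otimes>\<^bsub>?H\<^esub> g y"
      using f_mult[OF p(1) p'(1)] p(2) p'(2) by simp
  qed
  then have "g \<in> iso (G\<lparr>carrier := plane a b\<rparr>) ?H"
    using bij_betw_inv_into[OF bij] by (simp add: iso_def g_def)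
  then show ?thesis
    by (rule is_isoI)
qed

text \<open>Bilinearity extends commutation from the basis vectors to whole planes, and generation
  reduces to spanning \<open>'v\<close>.\<close>

lemma central_product_planes:
  assumes orth: "\<And>i j x y. \<lbrakk>i \<in> I; j \<in> I; i \<noteq> j; x \<in> {a i, b i}; y \<in> {a j, b j}\<rbrakk> \<Longrightarrow> \<beta> x y = \<beta> y x"
    and span: "\<And>S. \<lbrakk>0 \<in> S; \<And>i. i \<in> I \<Longrightarrow> a i \<in> S \<and> b i \<in> S;
      \<And>x y. x \<in> S \<Longrightarrow> y \<in> S \<Longrightarrow> x + y \<in> S\<rbrakk> \<Longrightarrow> S = UNIV"
  shows "central_product G I (\<lambda>i. plane (a i) (b i))"
  unfolding central_product_def
proof (intro conjI ballI impI group_G subgroup_plane)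
  fix i j g h
  assume ij: "i \<in> I" "j \<in> I" "i \<noteq> j" and "g \<in> plane (a i) (b i)" "h \<in> plane (a j) (b j)"
  then obtain s x t y where gh: "g = e (s, x)" "h = e (t, y)"
    and x: "x \<in> {0, a i, b i, a i + b i}" and y: "y \<in> {0, a j, b j, a j + b j}"
    unfolding plane_def by blast
  have o: "\<beta> (a i) (a j) = \<beta> (a j) (a i)" "\<beta> (a i) (b j) = \<beta> (b j) (a i)"
     "\<beta> (b i) (a j) = \<beta> (a j) (b i)" "\<beta> (b i) (b j) = \<beta> (b j) (b i)"
    by (rule orth[OF ij]; simp)+
  have "\<beta> x y = \<beta> y x"
    using x y by (elim insertE emptyE)
      (simp_all only: o add_left add_right zero_left zero_right add_0 ac_simps)
  then show "g \<otimes>\<^bsub>G\<^esub> h = h \<otimes>\<^bsub>G\<^esub> g"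
    by (simp add: gh commute_iff)
next
  show "generate G (\<Union>i\<in>I. plane (a i) (b i)) = carrier G"
  proof (rule generate_eq_carrier)
    show "(\<Union>i\<in>I. plane (a i) (b i)) \<subseteq> carrier G"
      using subgroup.subset[OF subgroup_plane] by blast
    fix S assume S: "\<And>s x. e (s, x) \<in> (\<Union>i\<in>I. plane (a i) (b i)) \<Longrightarrow> x \<in> S" "0 \<in> S"
      "\<And>x y. x \<in> S \<Longrightarrow> y \<in> S \<Longrightarrow> x + y \<in> S"
    have "a i \<in> S \<and> b i \<in> S" if "i \<in> I" for i
      using S(1)[of 0] that by (auto simp: plane_def)
    with S show "S = UNIV"
      by (intro span) auto
  qed
qed

text \<open>Where \<open>\<beta>\<close> vanishes, the product of \<open>e (0, x)\<close> and
  \<open>e (0, y)\<close> is \<open>e (0, x + y)\<close>. Applied to a point and itself this yields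
  involutions, applied to a line it yields (R2).\<close>

lemma nonabelian_representationI:
  fixes \<phi> :: "'a \<Rightarrow> 'v"
  assumes points: "\<And>p. p \<in> points S \<Longrightarrow> \<phi> p \<noteq> 0 \<and> \<beta> (\<phi> p) (\<phi> p) = 0"
    and lines: "\<And>x y z. \<lbrakk>distinct [x, y, z]; {x, y, z} \<in> lines S\<rbrakk> \<Longrightarrow>
      {x, y, z} \<subseteq> points S \<and> \<phi> x + \<phi> y = \<phi> z \<and> \<beta> (\<phi> x) (\<phi> y) = 0"
    and span: "\<And>T. \<lbrakk>0 \<in> T; \<And>p. p \<in> points S \<Longrightarrow> \<phi> p \<in> T;
      \<And>x y. x \<in> T \<Longrightarrow> y \<in> T \<Longrightarrow> x + y \<in> T\<rbrakk> \<Longrightarrow> T = UNIV"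
  shows "nonabelian_representation S G (\<lambda>p. e (0, \<phi> p))"
  unfolding nonabelian_representation_def representation_def
proof (intro conjI allI impI group_G not_comm_group_G)
  show "(\<lambda>p. e (0, \<phi> p)) ` points S \<subseteq> involutions G"
    using points by (auto simp: involutions_def e_in_carrier one_G mult_G e_eq_iff add_self)
  show "generate G ((\<lambda>p. e (0, \<phi> p)) ` points S) = carrier G"
  proof (rule generate_eq_carrier)
    show "(\<lambda>p. e (0, \<phi> p)) ` points S \<subseteq> carrier G"
      by (auto simp: e_in_carrier)
    fix T assume T: "\<And>s x. e (s, x) \<in> (\<lambda>p. e (0, \<phi> p)) ` points S \<Longrightarrow> x \<in> T" "0 \<in> T"
      "\<And>x y. x \<in> T \<Longrightarrow> y \<in> T \<Longrightarrow> x + y \<in> T"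
    have "\<phi> p \<in> T" if "p \<in> points S" for p
      using T(1)[of 0] that by blast
    with T show "T = UNIV"
      by (intro span) auto
  qed
  fix x y z assume xyz: "distinct [x, y, z] \<and> {x, y, z} \<in> lines S"
  then have *: "{x, y, z} \<subseteq> points S" "\<phi> x + \<phi> y = \<phi> z" "\<beta> (\<phi> x) (\<phi> y) = 0"
    using lines by blast+
  then have "\<phi> x \<noteq> 0" "\<phi> y \<noteq> 0" "\<phi> z \<noteq> 0"
    using points by blast+
  \<comment> \<open>If two of the three vectors agreed, the remaining one would be zero.\<close>
  with *(2) have "\<phi> x \<noteq> \<phi> y" "\<phi> x \<noteq> \<phi> z" "\<phi> y \<noteq> \<phi> z"
    using add_self by auto
  then show "inj_on (\<lambda>p. e (0, \<phi> p)) {x, y, z}"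
    by (auto simp: inj_on_def e_eq_iff)
  show "e (0, \<phi> x) \<otimes>\<^bsub>G\<^esub> e (0, \<phi> y) = e (0, \<phi> z)"
    using * by (simp add: mult_G)
qed

end

section \<open>Forms on powers of GF(2)^2 built from one local form\<close>

lemma sum_closed:
  assumes "finite A" "0 \<in> S" "\<And>x y. x \<in> S \<Longrightarrow> y \<in> S \<Longrightarrow> x + y \<in> S" "\<And>i. i \<in> A \<Longrightarrow> f i \<in> S"
  shows "sum f A \<in> S"
  using assms by (induction A rule: finite_induct) auto

lemma axis_nth_if: "axis i p $ j = (if j = i then p else 0)"
  by (simp add: axis_def)

lemma sum_axis: "(\<Sum>j\<in>UNIV. axis j (x $ j)) = (x :: 'a::comm_monoid_add ^ 'n)"
  by (simp add: vec_eq_iff axis_def)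

lemma bit_pair_cases: "p = (0, 0) \<or> p = (1, 0) \<or> p = (0, 1) \<or> p = (1, 1 :: bit)" for p :: "bit \<times> bit"
  by (cases p; cases "fst p"; cases "snd p"; simp)

text \<open>The common shape of both forms: a local form \<open>c\<close> on GF(2)^2 couples each
  coordinate \<open>i\<close> with its partner \<open>\<sigma> i\<close>.
  \<open>c_alternating\<close> makes the commutator form of \<open>c\<close> nonzero.\<close>

locale coordinate_cocycle =
  fixes c :: "bit \<times> bit \<Rightarrow> bit \<times> bit \<Rightarrow> bit" and \<sigma> :: "'n::finite \<Rightarrow> 'n"
    and e :: "bit \<times> ((bit \<times> bit) ^ 'n) \<Rightarrow> 'g"
  assumes c_add_left: "c (p + p') q = c p q + c p' q"
    and c_add_right: "c p (q + q') = c p q + c p q'"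
    and c_alternating: "c (1, 0) (0, 1) \<noteq> c (0, 1) (1, 0)"
    and \<sigma>_involution: "\<sigma> (\<sigma> i) = i"
    and inj_e: "inj e"
begin

definition \<beta> :: "(bit \<times> bit) ^ 'n \<Rightarrow> (bit \<times> bit) ^ 'n \<Rightarrow> bit" where
  "\<beta> x y = (\<Sum>i\<in>UNIV. c (x $ i) (y $ \<sigma> i))"

lemma c_zero_left: "c 0 q = 0"
  using c_add_left[of 0 0 q] by simp

lemma c_zero_right: "c p 0 = 0"
  using c_add_right[of p 0 0] by simp

lemma \<beta>_axis_left: "\<beta> (axis j p) y = c p (y $ \<sigma> j)"
proof -
  have "\<beta> (axis j p) y = (\<Sum>i\<in>UNIV. if i = j then c p (y $ \<sigma> j) else 0)"
    unfolding \<beta>_def by (rule sum.cong) (auto simp: axis_def c_zero_left)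
  then show ?thesis
    by simp
qed

lemma \<beta>_axis_right: "\<beta> x (axis j q) = c (x $ \<sigma> j) q"
proof -
  have "\<sigma> i = j \<longleftrightarrow> i = \<sigma> j" for i
    using \<sigma>_involution by metis
  then have "\<beta> x (axis j q) = (\<Sum>i\<in>UNIV. if i = \<sigma> j then c (x $ \<sigma> j) q else 0)"
    unfolding \<beta>_def by (intro sum.cong) (auto simp: axis_def c_zero_right)
  then show ?thesis
    by simp
qed

text \<open>A nonzero alternating form on a two-dimensional space is nondegenerate.\<close>

lemma c_nondegenerate:
  assumes "p \<noteq> 0"
  shows "\<exists>q. c p q \<noteq> c q p"
proof -
  have "((1, 1) :: bit \<times> bit) = (1, 0) + (0, 1)"
    by simp
  then have "c (1, 1) (1, 0) \<noteq> c (1, 0) (1, 1)"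
    using c_alternating by (simp only: c_add_left c_add_right) auto
  then show ?thesis
    using assms bit_pair_cases[of p] c_alternating by (auto simp: zero_prod_def)
qed

sublocale bilinear_group \<beta> e
proof
  show "\<beta> (x + y) z = \<beta> x z + \<beta> y z" for x y z
    unfolding \<beta>_def by (simp only: c_add_left sum.distrib vector_add_component)
  show "\<beta> x (y + z) = \<beta> x y + \<beta> x z" for x y z
    unfolding \<beta>_def by (simp only: c_add_right sum.distrib vector_add_component)
  show "x + x = 0" for x :: "(bit \<times> bit) ^ 'n"
    by (simp add: vec_eq_iff prod_eq_iff)
  show "\<exists>y. \<beta> x y \<noteq> \<beta> y x" if "x \<noteq> 0" for x
  proof -
    obtain j where "x $ j \<noteq> 0"
      using \<open>x \<noteq> 0\<close> by (auto simp: vec_eq_iff)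
    then obtain q where "c (x $ j) q \<noteq> c q (x $ j)"
      using c_nondegenerate by blast
    \<comment> \<open>The test vector sits at \<open>\<sigma> j\<close>, the coordinate that
      \<open>\<beta>\<close> couples with \<open>j\<close>.\<close>
    then show ?thesis
      by (intro exI[of _ "axis (\<sigma> j) q"]) (simp add: \<beta>_axis_left \<beta>_axis_right \<sigma>_involution)
  qed
  show "\<exists>x :: (bit \<times> bit) ^ 'n. x \<noteq> 0"
    by (rule exI[of _ "axis undefined (1, 0)"]) (simp add: axis_eq_0_iff zero_prod_def)
  show "inj e"
    by (rule inj_e)
qed

lemma card_vectors: "CARD((bit \<times> bit) ^ 'n) = 2 ^ (2 * CARD('n))"
  by (simp add: CARD_bit power_mult)

text \<open>Placing (1,0) at a coordinate and (0,1) at its partner makes a pair with nonzero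
  commutator. Two distinct planes can interact only when \<open>\<sigma>\<close> swaps their
  coordinates, and then only through two copies of the same local vector, on which \<open>c\<close>
  is symmetric.\<close>

lemma central_product_axes:
  assumes "bij_betw \<pi> {..<m} (UNIV :: 'n set)"
  shows "central_product G {..<m} (\<lambda>k. plane (axis (\<pi> k) (1, 0)) (axis (\<sigma> (\<pi> k)) (0, 1)))"
proof (rule central_product_planes)
  fix k l x y
  assume "k \<in> {..<m}" "l \<in> {..<m}" "k \<noteq> l"
  then have "\<pi> k \<noteq> \<pi> l"
    using assms by (auto simp: bij_betw_def inj_on_def)
  moreover from this have "\<sigma> (\<pi> k) \<noteq> \<sigma> (\<pi> l)" "\<sigma> (\<pi> k) = \<pi> l \<longleftrightarrow> \<sigma> (\<pi> l) = \<pi> k"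
    using \<sigma>_involution by metis+
  ultimately show "\<beta> x y = \<beta> y x"
    if "x \<in> {axis (\<pi> k) (1, 0), axis (\<sigma> (\<pi> k)) (0, 1)}" "y \<in> {axis (\<pi> l) (1, 0), axis (\<sigma> (\<pi> l)) (0, 1)}"
    using that by (elim insertE emptyE)
      (simp_all add: \<beta>_axis_left axis_nth_if c_zero_right \<sigma>_involution)
next
  fix S :: "((bit \<times> bit) ^ 'n) set"
  assume S: "0 \<in> S" "\<And>k. k \<in> {..<m} \<Longrightarrow> axis (\<pi> k) (1, 0) \<in> S \<and> axis (\<sigma> (\<pi> k)) (0, 1) \<in> S"
    "\<And>x y. x \<in> S \<Longrightarrow> y \<in> S \<Longrightarrow> x + y \<in> S"
  have 1: "axis j (1, 0) \<in> S \<and> axis (\<sigma> j) (0, 1) \<in> S" for j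
    using S(2) bij_betw_imp_surj_on[OF assms] by (metis UNIV_I imageE)
  have 2: "axis j (0, 1) \<in> S" for j
    using 1[of "\<sigma> j"] by (simp add: \<sigma>_involution)
  have "axis j (1, 1) = axis j (1, 0) + (axis j (0, 1) :: (bit \<times> bit) ^ 'n)"
    "axis j (0, 0) = (0 :: (bit \<times> bit) ^ 'n)" for j
    by (auto simp: vec_eq_iff axis_def zero_prod_def)
  then have "axis j p \<in> S" for j p
    using bit_pair_cases[of p] 1 2 S(1,3) by metis
  then have "x \<in> S" for x
    using sum_closed[of UNIV S "\<lambda>j. axis j (x $ j)"] S(1,3) by (simp add: sum_axis)
  then show "S = UNIV"
    by blast
qed

text \<open>An axis vector at a coordinate moved by \<open>\<sigma>\<close> has square zero since it
  never meets its partner. Only a fixed coordinate sees the local squares \<open>t\<close>.\<close>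

lemma plane_axes_iso:
  assumes "c (1, 0) (1, 0) = t" "c (0, 1) (0, 1) = t"
  shows "G\<lparr>carrier := plane (axis i (1, 0)) (axis (\<sigma> i) (0, 1))\<rparr> \<cong> (if \<sigma> i = i \<and> t = 1 then Q8 else D8)"
proof -
  have "\<beta> (axis i (1, 0)) (axis i (1, 0)) = (if \<sigma> i = i then t else 0)"
    "\<beta> (axis (\<sigma> i) (0, 1)) (axis (\<sigma> i) (0, 1)) = (if \<sigma> i = i then t else 0)"
    using assms by (auto simp: \<beta>_axis_left axis_nth_if c_zero_right \<sigma>_involution)
  moreover have "\<beta> (axis i (1, 0)) (axis (\<sigma> i) (0, 1)) \<noteq> \<beta> (axis (\<sigma> i) (0, 1)) (axis i (1, 0))"
    using c_alternating by (simp add: \<beta>_axis_left axis_nth_if \<sigma>_involution)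
  ultimately have "G\<lparr>carrier := plane (axis i (1, 0)) (axis (\<sigma> i) (0, 1))\<rparr> \<cong>
      (if (if \<sigma> i = i then t else 0) = 0 then D8 else Q8)"
    by (intro plane_iso)
  then show ?thesis
    by (cases t) (auto split: if_splits)
qed

lemma order_G_coordinates: "order G = 2 ^ (1 + 2 * CARD('n))"
  by (simp only: order_G card_vectors) simp

lemma extra_special_plus_G:
  assumes "c (1, 0) (1, 0) = 0" "c (0, 1) (0, 1) = 0"
  shows "extra_special_plus CARD('n) G"
proof -
  obtain \<pi> where \<pi>: "bij_betw \<pi> {..<CARD('n)} (UNIV :: 'n set)"
    using ex_bij_betw_nat_finite[of "UNIV :: 'n set"] by (auto simp: atLeast0LessThan)
  show ?thesis
    unfolding extra_special_plus_def
    using central_product_axes[OF \<pi>] plane_axes_iso[OF assms] extra_special_G[OF card_vectors]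
      order_G_coordinates by (auto intro!: exI[of _ "\<lambda>k. plane (axis (\<pi> k) (1, 0)) (axis (\<sigma> (\<pi> k)) (0, 1))"])
qed

lemma extra_special_minus_G:
  assumes c: "c (1, 0) (1, 0) = 1" "c (0, 1) (0, 1) = 1" and fixpt: "\<And>i. \<sigma> i = i \<longleftrightarrow> i = i\<^sub>0"
  shows "extra_special_minus CARD('n) G"
proof -
  obtain \<pi>' where \<pi>': "bij_betw \<pi>' {..<CARD('n)} (UNIV :: 'n set)"
    using ex_bij_betw_nat_finite[of "UNIV :: 'n set"] by (auto simp: atLeast0LessThan)
  \<comment> \<open>The enumeration is adjusted to put the fixed coordinate first, because
    \<open>extra_special_minus\<close> has its quaternion factor at index 0.\<close>
  define \<pi> where "\<pi> = Transposition.transpose (\<pi>' 0) i\<^sub>0 \<circ> \<pi>'"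
  have \<pi>: "bij_betw \<pi> {..<CARD('n)} UNIV"
    unfolding \<pi>_def using \<pi>' by (rule bij_betw_trans) simp
  have "\<pi> 0 = i\<^sub>0"
    by (simp add: \<pi>_def)
  then have "\<sigma> (\<pi> k) = \<pi> k \<longleftrightarrow> k = 0" if "k < CARD('n)" for k
    using that inj_onD[OF bij_betw_imp_inj_on[OF \<pi>], of k 0] by (auto simp: fixpt)
  then have "G\<lparr>carrier := plane (axis (\<pi> k) (1, 0)) (axis (\<sigma> (\<pi> k)) (0, 1))\<rparr> \<cong> (if k = 0 then Q8 else D8)"
    if "k < CARD('n)" for k
    using plane_axes_iso[OF c, of "\<pi> k"] that by simp
  then show ?thesis
    unfolding extra_special_minus_def
    using central_product_axes[OF \<pi>] extra_special_G[OF card_vectors] order_G_coordinates by blast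
qed

end

section \<open>Near hexagons with an explicit distance function\<close>

text \<open>\<open>step\<close> produces a path of length \<open>D x y\<close>, while
  \<open>gate\<close> keeps \<open>D\<close> from growing by more than one along a line; together
  they force \<open>D\<close> to be the distance. The third-point function \<open>t\<close> ensures
  that two points determine their line.\<close>

lemma slim_dense_near_hexagonI:
  fixes S :: "'a geometry" and D :: "'a \<Rightarrow> 'a \<Rightarrow> nat" and t :: "'a \<Rightarrow> 'a \<Rightarrow> 'a"
  assumes line: "\<And>l. l \<in> lines S \<Longrightarrow> l \<subseteq> points S \<and> card l = 3"
    and third: "\<And>l x y. \<lbrakk>l \<in> lines S; x \<in> l; y \<in> l; x \<noteq> y\<rbrakk> \<Longrightarrow> l = {x, y, t x y}"
    and zero: "\<And>x. x \<in> points S \<Longrightarrow> D x x = 0"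
    and gate: "\<And>p l. \<lbrakk>p \<in> points S; l \<in> lines S\<rbrakk> \<Longrightarrow> \<exists>q\<in>l. \<forall>r\<in>l. r \<noteq> q \<longrightarrow> D p r = Suc (D p q)"
    and step: "\<And>x y. \<lbrakk>x \<in> points S; y \<in> points S; x \<noteq> y\<rbrakk> \<Longrightarrow>
      \<exists>z. (z, y) \<in> collinearity S \<and> D x y = Suc (D x z)"
    and bound: "\<And>x y. \<lbrakk>x \<in> points S; y \<in> points S\<rbrakk> \<Longrightarrow> D x y \<le> 3"
    and diam: "\<exists>x\<in>points S. \<exists>y\<in>points S. D x y = 3"
    and dense: "\<And>x y. \<lbrakk>x \<in> points S; y \<in> points S; D x y = 2\<rbrakk> \<Longrightarrow>
      \<exists>a b. a \<noteq> b \<and> {(x, a), (a, y), (x, b), (b, y)} \<subseteq> collinearity S"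
  shows "slim_dense_near_hexagon S"
proof -
  have coll_points: "x \<in> points S" "y \<in> points S" if "(x, y) \<in> collinearity S" for x y
    using that line by (auto simp: collinearity_def)
  have upper: "(x, y) \<in> collinearity S ^^ n" if "x \<in> points S" "y \<in> points S" "D x y = n" for x y n
    using that
  proof (induction n arbitrary: y)
    case 0
    then have "x = y"
      using step by fastforce
    then show ?case
      by simp
  next
    case (Suc n)
    then have "x \<noteq> y"
      using zero by auto
    then obtain z where z: "(z, y) \<in> collinearity S" "D x y = Suc (D x z)"
      using step Suc.prems by blast
    then have "(x, z) \<in> collinearity S ^^ n"
      using Suc coll_points by auto
    then show ?case
      using z by auto
  qed
  have lower: "D x y \<le> n" if "x \<in> points S" "(x, y) \<in> collinearity S ^^ n" for x y n
    using that
  proof (induction n arbitrary: y)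
    case 0
    then show ?case
      using zero by simp
  next
    case (Suc n)
    then obtain z where z: "(x, z) \<in> collinearity S ^^ n" "(z, y) \<in> collinearity S"
      by auto
    then obtain l where l: "l \<in> lines S" "z \<in> l" "y \<in> l"
      by (auto simp: collinearity_def)
    then obtain q where "\<forall>r\<in>l. r \<noteq> q \<longrightarrow> D x r = Suc (D x q)"
      using gate Suc.prems by meson
    \<comment> \<open>On a line, \<open>D x\<close> takes only two values, which differ by
      one.\<close>
    then have "D x y \<le> Suc (D x z)"
      using l by (cases "y = q"; cases "z = q") auto
    also have "D x z \<le> n"
      using Suc z by blast
    finally show ?case
      by simp
  qed
  have dist: "pdist S x y = enat (D x y)" if "x \<in> points S" "y \<in> points S" for x y
    unfolding pdist_def
    by (rule antisym; rule Inf_lower Inf_greatest) (use that upper lower in auto)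
  have pls: "partial_linear_space S"
    unfolding partial_linear_space_def
  proof (intro conjI ballI allI impI)
    fix l assume "l \<in> lines S"
    then have "l \<subseteq> points S" "card l = 3"
      using line by auto
    then show "l \<subseteq> points S" "\<exists>x\<in>l. \<exists>y\<in>l. x \<noteq> y"
      by (auto simp: card_3_iff)
  next
    fix x y l l'
    assume "l \<in> lines S \<and> l' \<in> lines S \<and> x \<noteq> y \<and> {x, y} \<subseteq> l \<and> {x, y} \<subseteq> l'"
    then have "l = {x, y, t x y}" "l' = {x, y, t x y}"
      using third by auto
    then show "l = l'"
      by simp
  qed
  have polygon: "near_polygon S"
    unfolding near_polygon_def
  proof (intro conjI ballI pls)
    fix p l assume p: "p \<in> points S" and l: "l \<in> lines S"
    then obtain q where q: "q \<in> l" "\<forall>r\<in>l. r \<noteq> q \<longrightarrow> D p r = Suc (D p q)"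
      using gate by blast
    have eq: "pdist S p r = enat (D p r)" if "r \<in> l" for r
      using dist[OF p] line[OF l] that by auto
    show "\<exists>!q. q \<in> l \<and> (\<forall>r\<in>l. pdist S p q \<le> pdist S p r)"
    proof (rule ex1I[of _ q])
      show "q \<in> l \<and> (\<forall>r\<in>l. pdist S p q \<le> pdist S p r)"
        using q eq by (metis enat_ord_simps(1) le_SucI order_refl)
      show "q' = q" if "q' \<in> l \<and> (\<forall>r\<in>l. pdist S p q' \<le> pdist S p r)" for q'
        using q eq that by (metis enat_ord_simps(1) not_less_eq_eq order_refl)
    qed
  qed
  have "near_hexagon S"
    unfolding near_hexagon_def
  proof (intro conjI polygon ballI)
    show "pdist S x y \<le> 3" if "x \<in> points S" "y \<in> points S" for x y
      using dist[OF that] bound[OF that] by (simp add: numeral_eq_enat)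
    show "\<exists>x\<in>points S. \<exists>y\<in>points S. pdist S x y = 3"
      using diam dist by (metis numeral_eq_enat)
  qed
  moreover have "dense S"
    unfolding dense_def
    using line dense dist by (force simp: numeral_eq_enat)
  ultimately show ?thesis
    using line by (simp add: slim_dense_near_hexagon_def slim_def)
qed

section \<open>The glued near hexagon\<close>

lemma UNIV_3: "(UNIV :: 3 set) = {0, 1, 2}"
  by (rule card_subset_eq[symmetric]) auto

lemma UNIV_2: "(UNIV :: 2 set) = {0, 1}"
  by (rule card_subset_eq[symmetric]) auto

lemma all_2: "(\<forall>k::2. P k) \<longleftrightarrow> P 0 \<and> P 1"
  using UNIV_2 by (metis UNIV_I empty_iff insert_iff)

lemma vec_2_eq_iff: "(u :: 'a ^ 2) = v \<longleftrightarrow> u $ 0 = v $ 0 \<and> u $ 1 = v $ 1"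
  by (simp add: vec_eq_iff all_2)

lemma cases_3: obtains "k = (0::3)" | "k = 1" | "k = 2"
  using UNIV_3 by blast

lemma triple_3: "3 * (a::3) = 0"
  by (cases a rule: cases_3) simp_all

lemma square_3: "(a::3) \<noteq> 0 \<Longrightarrow> a * a = 1"
  by (cases a rule: cases_3) simp_all

lemma mult_3_eq_0_iff: "(a::3) * b = 0 \<longleftrightarrow> a = 0 \<or> b = 0"
  by (cases a rule: cases_3; cases b rule: cases_3) simp_all

lemma sum_line_3: "(a::3) + (a + b) + (a + 2 * b) = 0"
  by (cases a rule: cases_3; cases b rule: cases_3) simp_all

lemma range_3: "range (f :: 3 \<Rightarrow> 'a) = {f 0, f 1, f 2}"
  by (simp add: UNIV_3)

lemma symp_self: "\<Delta> u u = 0"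
  by (simp add: symp_def)

lemma symp_add_right: "\<Delta> u (v + w) = \<Delta> u v + \<Delta> u w"
  and symp_add_left: "\<Delta> (v + w) u = \<Delta> v u + \<Delta> w u"
  and symp_diff_right: "\<Delta> u (v - w) = \<Delta> u v - \<Delta> u w"
  and symp_diff_left: "\<Delta> (v - w) u = \<Delta> v u - \<Delta> w u"
  and symp_smult_right: "\<Delta> u (k *s v) = k * \<Delta> u v"
  and symp_smult_left: "\<Delta> (k *s v) u = k * \<Delta> v u"
  by (simp_all add: symp_def algebra_simps)

text \<open>In dimension two the perp of \<open>d\<close> is the line through \<open>d\<close>. The
  coefficient is a quotient of coordinates, written as a product because nonzero elements of GF(3)
  are their own inverses.\<close>

lemma symp_eq_0:
  assumes "\<Delta> w d = 0" "d \<noteq> 0"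
  shows "\<exists>k. w = k *s d"
proof (cases "d $ 0 = 0")
  case False
  have eq: "w $ 0 * d $ 1 = w $ 1 * d $ 0"
    using assms(1) by (simp add: symp_def)
  have "w $ 1 = w $ 1 * d $ 0 * d $ 0"
    using square_3[OF False] by (simp add: mult.assoc)
  also have "\<dots> = w $ 0 * d $ 0 * d $ 1"
    unfolding eq[symmetric] by (simp add: ac_simps)
  finally have "w $ 1 = w $ 0 * d $ 0 * d $ 1" .
  moreover have "w $ 0 = w $ 0 * d $ 0 * d $ 0"
    using square_3[OF False] by (simp add: mult.assoc)
  ultimately have "w = (w $ 0 * d $ 0) *s d"
    by (simp only: vec_2_eq_iff vector_smult_component)
  then show ?thesis ..
next
  case True
  then have 1: "d $ 1 \<noteq> 0"
    using assms(2) by (simp add: vec_2_eq_iff)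
  have "w $ 0 = 0"
    using assms(1) True 1 by (simp add: symp_def mult_3_eq_0_iff)
  moreover have "w $ 1 = w $ 1 * d $ 1 * d $ 1"
    using square_3[OF 1] by (simp add: mult.assoc)
  ultimately have "w = (w $ 1 * d $ 1) *s d"
    using True by (simp only: vec_2_eq_iff vector_smult_component mult_zero_right)
  then show ?thesis ..
qed

lemma smult_left_cancel:
  assumes "d \<noteq> (0 :: 3 ^ 2)" "k *s d = k' *s d"
  shows "k = k'"
proof -
  have "(k - k') * d $ 0 = 0" "(k - k') * d $ 1 = 0"
    using assms(2) by (simp_all add: vec_2_eq_iff algebra_simps)
  then show ?thesis
    using assms(1) by (auto simp: mult_3_eq_0_iff vec_2_eq_iff)
qed

text \<open>The gate property inside one copy of Q(5,2). If \<open>m = 0\<close>, the line meets the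
  fibre over \<open>u\<close>: the second summand is constant and the gate is the meeting point.
  Otherwise the first summand is constantly 1 and the gate is the root of an affine function of
  \<open>k\<close> with slope \<open>m\<close>.\<close>

lemma gate_line:
  assumes d: "d \<noteq> 0"
  shows "\<exists>k\<^sub>0. \<forall>k. k \<noteq> k\<^sub>0 \<longrightarrow>
    of_bool (u \<noteq> w + k *s d) + of_bool (j + k * \<Delta> w d \<noteq> i + \<Delta> u (w + k *s d)) =
    Suc (of_bool (u \<noteq> w + k\<^sub>0 *s d) + of_bool (j + k\<^sub>0 * \<Delta> w d \<noteq> i + \<Delta> u (w + k\<^sub>0 *s d)))"
proof -
  define s m where "s = j - i - \<Delta> u w" and "m = \<Delta> (w - u) d"
  have *: "j + k * \<Delta> w d = i + \<Delta> u (w + k *s d) \<longleftrightarrow> s + k * m = 0" for k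
  proof -
    have "s + k * m = (j + k * \<Delta> w d) - (i + \<Delta> u (w + k *s d))"
      by (simp add: s_def m_def symp_add_right symp_diff_left symp_smult_right algebra_simps)
    then show ?thesis
      by simp
  qed
  show ?thesis
  proof (cases "m = 0")
    case True
    then obtain k\<^sub>1 where "w - u = k\<^sub>1 *s d"
      using symp_eq_0[of "w - u" d] d unfolding m_def by blast
    then have "u = w + (- k\<^sub>1) *s d"
      by (simp add: vec_2_eq_iff algebra_simps)
    then obtain k\<^sub>0 where "u = w + k\<^sub>0 *s d"
      by blast
    then have "u = w + k *s d \<longleftrightarrow> k = k\<^sub>0" for k
      using smult_left_cancel[OF d] by auto
    then show ?thesis
      using True by (intro exI[of _ k\<^sub>0]) (simp add: *)
  next
    case False
    have "u \<noteq> w + k *s d" for k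
      using False by (auto simp: m_def symp_diff_left symp_add_left symp_smult_left symp_self)
    \<comment> \<open>The root is -s/m, and 1/m is \<open>m\<close> in GF(3).\<close>
    moreover have "s + k * m = 0 \<longleftrightarrow> k = - (s * m)" for k
    proof
      assume "s + k * m = 0"
      then have "(s + k * m) * m = 0"
        by simp
      then have "s * m + k * (m * m) = 0"
        by (simp add: algebra_simps)
      then show "k = - (s * m)"
        using square_3[OF False] by (simp add: add_eq_0_iff)
    next
      assume "k = - (s * m)"
      then have "s + k * m = s - s * (m * m)"
        by (simp add: algebra_simps)
      then show "s + k * m = 0"
        using square_3[OF False] by simp
    qed
    ultimately show ?thesis
      by (simp only: *) auto
  qed
qed

text \<open>A shortest path changes \<open>u\<close> and \<open>v\<close> at most once each,
  shifting the first coordinate by \<open>\<Delta> u u' + \<Delta> v v'\<close>; any remaining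
  discrepancy costs one step in a fibre.\<close>

definition glued_dist :: "3 \<times> (3 ^ 2) \<times> (3 ^ 2) \<Rightarrow> 3 \<times> (3 ^ 2) \<times> (3 ^ 2) \<Rightarrow> nat" where
  "glued_dist = (\<lambda>(i, u, v) (j, u', v').
     of_bool (u \<noteq> u') + of_bool (v \<noteq> v') + of_bool (j \<noteq> i + \<Delta> u u' + \<Delta> v v'))"

section \<open>Lines and distances of the glued geometry\<close>

lemma glued_lines_cases:
  assumes "l \<in> lines Q52_glued_Q52"
  obtains u v where "l = range (\<lambda>k. (k, u, v))"
  | i u v d where "d \<noteq> 0" "l = range (\<lambda>k. (i + k * \<Delta> u d, u + k *s d, v))"
  | i u v d where "d \<noteq> 0" "l = range (\<lambda>k. (i + k * \<Delta> v d, u, v + k *s d))"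
  using assms unfolding Q52_glued_Q52_def snd_conv by blast

lemma glued_lines_intros:
  "range (\<lambda>k::3. (k, u, v)) \<in> lines Q52_glued_Q52"
  "d \<noteq> 0 \<Longrightarrow> range (\<lambda>k. (i + k * \<Delta> u d, u + k *s d, v)) \<in> lines Q52_glued_Q52"
  "d \<noteq> 0 \<Longrightarrow> range (\<lambda>k. (i + k * \<Delta> v d, u, v + k *s d)) \<in> lines Q52_glued_Q52"
  unfolding Q52_glued_Q52_def snd_conv
  by (rule UnI1, rule UnI1, blast) (rule UnI1, rule UnI2, blast, rule UnI2, blast)

text \<open>All three kinds of lines are affine lines of GF(3)^5, hence their points sum to zero.
  This gives the third point as a function of the other two.\<close>

lemma glued_line_param:
  assumes "l \<in> lines Q52_glued_Q52"
  obtains f :: "3 \<Rightarrow> 3 \<times> (3 ^ 2) \<times> (3 ^ 2)" where "l = range f" "inj f" "f 0 + f 1 + f 2 = 0"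
  using assms
proof (cases l rule: glued_lines_cases)
  case (1 u v)
  let ?f = "\<lambda>k::3. (k, u, v)"
  have "inj ?f"
    by (auto intro: injI)
  moreover have "?f 0 + ?f 1 + ?f 2 = 0"
    by (simp add: vec_2_eq_iff triple_3 zero_prod_def)
  ultimately show ?thesis
    using 1 that by blast
next
  case (2 i u v d)
  let ?f = "\<lambda>k. (i + k * \<Delta> u d, u + k *s d, v)"
  have "inj ?f"
    by (auto intro!: injI dest: smult_left_cancel[OF 2(1)])
  moreover have "?f 0 + ?f 1 + ?f 2 = 0"
    by (simp add: vec_2_eq_iff triple_3 sum_line_3 zero_prod_def)
  ultimately show ?thesis
    using 2 that by blast
next
  case (3 i u v d)
  let ?f = "\<lambda>k. (i + k * \<Delta> v d, u, v + k *s d)"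
  have "inj ?f"
    by (auto intro!: injI dest: smult_left_cancel[OF 3(1)])
  moreover have "?f 0 + ?f 1 + ?f 2 = 0"
    by (simp add: vec_2_eq_iff triple_3 sum_line_3 zero_prod_def)
  ultimately show ?thesis
    using 3 that by blast
qed

lemma line_3_third:
  fixes f :: "3 \<Rightarrow> 'a::ab_group_add"
  assumes "f 0 + f 1 + f 2 = 0" "x \<in> range f" "y \<in> range f" "x \<noteq> y"
  shows "range f = {x, y, - (x + y)}"
proof -
  have third: "- (f 0 + f 1) = f 2" "- (f 1 + f 0) = f 2" "- (f 0 + f 2) = f 1" "- (f 2 + f 0) = f 1"
    "- (f 1 + f 2) = f 0" "- (f 2 + f 1) = f 0"
    using assms(1) by (simp_all only: neg_eq_iff_add_eq_0 ac_simps)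
  consider "x = f 0 \<and> y = f 1" | "x = f 1 \<and> y = f 0" | "x = f 0 \<and> y = f 2"
    | "x = f 2 \<and> y = f 0" | "x = f 1 \<and> y = f 2" | "x = f 2 \<and> y = f 1"
    using assms(2-4) unfolding range_3 by blast
  then show ?thesis
    by cases (auto simp only: range_3 third)
qed

lemma collinear_glued:
  assumes "glued_dist x y = 1"
  shows "(x, y) \<in> collinearity Q52_glued_Q52"
proof -
  obtain i u v j u' v' where xy: "x = (i, u, v)" "y = (j, u', v')"
    by (metis surj_pair)
  consider "u \<noteq> u'" "v = v'" "j = i + \<Delta> u u'" | "u = u'" "v \<noteq> v'" "j = i + \<Delta> v v'"
    | "u = u'" "v = v'" "j \<noteq> i"
    using assms
    by (cases "u = u'"; cases "v = v'"; cases "j = i + \<Delta> u u' + \<Delta> v v'")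
      (auto simp: xy glued_dist_def symp_self)
  then have "\<exists>l\<in>lines Q52_glued_Q52. x \<in> l \<and> y \<in> l"
  proof cases
    case 1
    then show ?thesis
      using glued_lines_intros(2)[of "u' - u" i u v]
      by (intro bexI[of _ "range (\<lambda>k. (i + k * \<Delta> u (u' - u), u + k *s (u' - u), v))"])
        (auto simp: xy range_3 symp_diff_right symp_self)
  next
    case 2
    then show ?thesis
      using glued_lines_intros(3)[of "v' - v" i v u]
      by (intro bexI[of _ "range (\<lambda>k. (i + k * \<Delta> v (v' - v), u, v + k *s (v' - v)))"])
        (auto simp: xy range_3 symp_diff_right symp_self)
  next
    case 3
    then show ?thesis
      using glued_lines_intros(1)[of u v] by (intro bexI[of _ "range (\<lambda>k. (k, u, v))"]) (auto simp: xy)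
  qed
  moreover have "x \<noteq> y"
    using assms by (auto simp: xy glued_dist_def symp_self)
  ultimately show ?thesis
    by (simp add: collinearity_def)
qed

lemma glued_gate:
  assumes "l \<in> lines Q52_glued_Q52"
  shows "\<exists>q\<in>l. \<forall>r\<in>l. r \<noteq> q \<longrightarrow> glued_dist p r = Suc (glued_dist p q)"
proof -
  obtain i u v where p: "p = (i, u, v)"
    by (metis surj_pair)
  from assms show ?thesis
  proof (cases l rule: glued_lines_cases)
    case (1 u' v')
    then show ?thesis
      by (auto simp: p glued_dist_def intro!: exI[of _ "i + \<Delta> u u' + \<Delta> v v'"])
  next
    case (2 j u' v' d)
    \<comment> \<open>The fixed second component contributes a constant, and its shift
      \<open>\<Delta> v v'\<close> is absorbed into the starting value \<open>i\<close>.\<close>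
    obtain k\<^sub>0 where k: "\<forall>k. k \<noteq> k\<^sub>0 \<longrightarrow>
        of_bool (u \<noteq> u' + k *s d) + of_bool (j + k * \<Delta> u' d \<noteq> i + \<Delta> v v' + \<Delta> u (u' + k *s d)) =
        Suc (of_bool (u \<noteq> u' + k\<^sub>0 *s d) + of_bool (j + k\<^sub>0 * \<Delta> u' d \<noteq> i + \<Delta> v v' + \<Delta> u (u' + k\<^sub>0 *s d)))"
      using gate_line[OF 2(1)] by blast
    have *: "glued_dist p (j + k * \<Delta> u' d, u' + k *s d, v') = of_bool (v \<noteq> v') +
       (of_bool (u \<noteq> u' + k *s d) + of_bool (j + k * \<Delta> u' d \<noteq> i + \<Delta> v v' + \<Delta> u (u' + k *s d)))" for k
      by (simp add: p glued_dist_def ac_simps)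
    show ?thesis
      unfolding 2(2)
      by (rule bexI[OF _ rangeI[of _ k\<^sub>0]]) (use k in \<open>auto simp only: * add_Suc_right\<close>)
  next
    case (3 j u' v' d)
    obtain k\<^sub>0 where k: "\<forall>k. k \<noteq> k\<^sub>0 \<longrightarrow>
        of_bool (v \<noteq> v' + k *s d) + of_bool (j + k * \<Delta> v' d \<noteq> i + \<Delta> u u' + \<Delta> v (v' + k *s d)) =
        Suc (of_bool (v \<noteq> v' + k\<^sub>0 *s d) + of_bool (j + k\<^sub>0 * \<Delta> v' d \<noteq> i + \<Delta> u u' + \<Delta> v (v' + k\<^sub>0 *s d)))"
      using gate_line[OF 3(1)] by blast
    have *: "glued_dist p (j + k * \<Delta> v' d, u', v' + k *s d) = of_bool (u \<noteq> u') +
       (of_bool (v \<noteq> v' + k *s d) + of_bool (j + k * \<Delta> v' d \<noteq> i + \<Delta> u u' + \<Delta> v (v' + k *s d)))" for k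
      by (simp add: p glued_dist_def ac_simps)
    show ?thesis
      unfolding 3(2)
      by (rule bexI[OF _ rangeI[of _ k\<^sub>0]]) (use k in \<open>auto simp only: * add_Suc_right\<close>)
  qed
qed

text \<open>The path is retraced from \<open>y\<close>: the change of \<open>u\<close> is undone
  first, then that of \<open>v\<close>, and finally the fibre step. Subtracting the corresponding
  \<open>\<Delta>\<close> keeps the new point collinear with \<open>y\<close>.\<close>

lemma glued_step:
  assumes "x \<noteq> y"
  shows "\<exists>z. (z, y) \<in> collinearity Q52_glued_Q52 \<and> glued_dist x y = Suc (glued_dist x z)"
proof -
  obtain i u v j u' v' where xy: "x = (i, u, v)" "y = (j, u', v')"
    by (metis surj_pair)
  consider "u \<noteq> u'" | "u = u'" "v \<noteq> v'" | "u = u'" "v = v'" "i \<noteq> j"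
    using assms xy by auto
  then have "\<exists>z. glued_dist z y = 1 \<and> glued_dist x y = Suc (glued_dist x z)"
  proof cases
    case 1
    then show ?thesis
      by (intro exI[of _ "(j - \<Delta> u u', u, v')"]) (auto simp: xy glued_dist_def symp_self algebra_simps)
  next
    case 2
    then show ?thesis
      by (intro exI[of _ "(j - \<Delta> v v', u, v)"]) (auto simp: xy glued_dist_def symp_self algebra_simps)
  next
    case 3
    then show ?thesis
      by (intro exI[of _ "(i, u, v)"]) (auto simp: xy glued_dist_def symp_self)
  qed
  then show ?thesis
    using collinear_glued by blast
qed

text \<open>Distance 2 means that exactly two of the three changes are needed; the two common
  neighbours come from performing them in either order.\<close>

lemma glued_dense:
  assumes "glued_dist x y = 2"
  shows "\<exists>a b. a \<noteq> b \<and> {(x, a), (a, y), (x, b), (b, y)} \<subseteq> collinearity Q52_glued_Q52"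
proof -
  obtain i u v j u' v' where xy: "x = (i, u, v)" "y = (j, u', v')"
    by (metis surj_pair)
  consider "u \<noteq> u'" "v \<noteq> v'" "j = i + \<Delta> u u' + \<Delta> v v'" | "u \<noteq> u'" "v = v'" "j \<noteq> i + \<Delta> u u'"
    | "u = u'" "v \<noteq> v'" "j \<noteq> i + \<Delta> v v'"
    using assms
    by (cases "u = u'"; cases "v = v'"; cases "j = i + \<Delta> u u' + \<Delta> v v'")
      (auto simp: xy glued_dist_def symp_self)
  then have "\<exists>a b. a \<noteq> b \<and> glued_dist x a = 1 \<and> glued_dist a y = 1 \<and> glued_dist x b = 1 \<and> glued_dist b y = 1"
  proof cases
    case 1
    then show ?thesis
      by (intro exI[of _ "(i + \<Delta> u u', u', v)"] exI[of _ "(i + \<Delta> v v', u, v')"])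
        (auto simp: xy glued_dist_def symp_self algebra_simps)
  next
    case 2
    then show ?thesis
      by (intro exI[of _ "(i + \<Delta> u u', u', v)"] exI[of _ "(j - \<Delta> u u', u, v)"])
        (auto simp: xy glued_dist_def symp_self algebra_simps)
  next
    case 3
    then show ?thesis
      by (intro exI[of _ "(i + \<Delta> v v', u, v')"] exI[of _ "(j - \<Delta> v v', u, v)"])
        (auto simp: xy glued_dist_def symp_self algebra_simps)
  qed
  then show ?thesis
    using collinear_glued by blast
qed

lemma slim_dense_near_hexagon_glued: "slim_dense_near_hexagon Q52_glued_Q52"
proof (rule slim_dense_near_hexagonI[where D = glued_dist and t = "\<lambda>x y. - (x + y)"])
  show "l \<subseteq> points Q52_glued_Q52 \<and> card l = 3" if "l \<in> lines Q52_glued_Q52" for l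
    using that by (rule glued_line_param) (simp add: card_image Q52_glued_Q52_def)
  show "l = {x, y, - (x + y)}" if "l \<in> lines Q52_glued_Q52" "x \<in> l" "y \<in> l" "x \<noteq> y" for l x y
    using that(1) by (rule glued_line_param) (use line_3_third that in blast)
  show "glued_dist x x = 0" for x
    by (auto simp: glued_dist_def symp_self split: prod.splits)
  show "glued_dist x y \<le> 3" for x y
    by (auto simp: glued_dist_def split: prod.splits)
  have "(1 :: 3 ^ 2) \<noteq> 0"
    by (simp add: vec_2_eq_iff)
  then have "glued_dist (0, 0, 0) (1, 1, 1) = 3"
    by (simp add: glued_dist_def symp_def)
  then show "\<exists>x\<in>points Q52_glued_Q52. \<exists>y\<in>points Q52_glued_Q52. glued_dist x y = 3"
    unfolding Q52_glued_Q52_def fst_conv by blast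
qed (rule glued_gate glued_step glued_dense; assumption)+

lemma card_points_glued: "card (points Q52_glued_Q52) = 243"
  unfolding Q52_glued_Q52_def fst_conv by simp

section \<open>The representation of the glued near hexagon\<close>

text \<open>The pair \<open>(a, b)\<close> stands for \<open>a + b \<omega>\<close> in \<open>GF(4)\<close>, where \<open>\<omega>\<^sup>2 = \<omega> + 1\<close>.\<close>

definition mul4 :: "bit \<times> bit \<Rightarrow> bit \<times> bit \<Rightarrow> bit \<times> bit" (infixl \<open>\<odot>\<close> 70) where
  "x \<odot> y = (fst x * fst y + snd x * snd y, fst x * snd y + snd x * fst y + snd x * snd y)"

text \<open>The Frobenius map of GF(4), since b \<omega>^2 = b + b \<omega> for b in GF(2).\<close>

definition conj4 :: "bit \<times> bit \<Rightarrow> bit \<times> bit" where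
  "conj4 x = (fst x + snd x, snd x)"

text \<open>The isomorphism k \<mapsto> \<omega>^k from the additive group of GF(3) onto the
  multiplicative group of GF(4).\<close>

definition omega :: "3 \<Rightarrow> bit \<times> bit" where
  "omega k = (if k = 0 then (1, 0) else if k = 1 then (0, 1) else (1, 1))"

section \<open>Field arithmetic of GF(4)\<close>

lemma cases_4:
  fixes x :: "bit \<times> bit"
  obtains "x = (0, 0)" | "x = (1, 0)" | "x = (0, 1)" | "x = (1, 1)"
  using bit_pair_cases by blast

lemma mul4_assoc: "x \<odot> y \<odot> z = x \<odot> (y \<odot> z)"
  by (cases x rule: cases_4; cases y rule: cases_4; cases z rule: cases_4) (simp_all add: mul4_def)

lemma mul4_commute: "x \<odot> y = y \<odot> x"
  by (cases x rule: cases_4; cases y rule: cases_4) (simp_all add: mul4_def)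

lemma mul4_left_commute: "x \<odot> (y \<odot> z) = y \<odot> (x \<odot> z)"
  by (metis mul4_assoc mul4_commute)

lemmas mul4_ac = mul4_assoc mul4_commute mul4_left_commute

lemma mul4_add_left: "(x + y) \<odot> z = x \<odot> z + y \<odot> z"
  by (cases x rule: cases_4; cases y rule: cases_4; cases z rule: cases_4) (simp_all add: mul4_def)

lemma mul4_add_right: "z \<odot> (x + y) = z \<odot> x + z \<odot> y"
  by (metis mul4_add_left mul4_commute)

lemma mul4_zero_left: "0 \<odot> x = 0"
  by (simp add: mul4_def zero_prod_def)

lemma mul4_zero_right: "x \<odot> 0 = 0"
  by (simp add: mul4_def zero_prod_def)

lemma mul4_one_left: "(1, 0) \<odot> x = x"
  by (cases x rule: cases_4) (simp_all add: mul4_def)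

lemma mul4_one_right: "x \<odot> (1, 0) = x"
  using mul4_one_left mul4_commute by metis

lemma mul4_eq_0_iff: "x \<odot> y = 0 \<longleftrightarrow> x = 0 \<or> y = 0"
  by (cases x rule: cases_4; cases y rule: cases_4) (simp_all add: mul4_def zero_prod_def)

lemma conj4_add: "conj4 (x + y) = conj4 x + conj4 y"
  by (cases x rule: cases_4; cases y rule: cases_4) (simp_all add: conj4_def)

lemma conj4_mul4: "conj4 (x \<odot> y) = conj4 x \<odot> conj4 y"
  by (cases x rule: cases_4; cases y rule: cases_4) (simp_all add: mul4_def conj4_def)

lemma mul4_sum_left: "sum f A \<odot> z = (\<Sum>a\<in>A. f a \<odot> z)"
  using sum_comp_morphism[of "\<lambda>x. x \<odot> z" f A] by (simp add: mul4_zero_left mul4_add_left comp_def)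

lemma mul4_sum_right: "z \<odot> sum f A = (\<Sum>a\<in>A. z \<odot> f a)"
  using sum_comp_morphism[of "\<lambda>x. z \<odot> x" f A] by (simp add: mul4_zero_right mul4_add_right comp_def)

lemma omega_add: "omega (a + b) = omega a \<odot> omega b"
  by (cases a rule: cases_3; cases b rule: cases_3) (simp_all add: omega_def mul4_def)

lemma omega_nonzero: "omega k \<noteq> 0"
  by (simp add: omega_def zero_prod_def)

lemma omega_surj:
  assumes "x \<noteq> 0"
  shows "\<exists>k. x = omega k"
proof (cases x rule: cases_4)
  case 1
  with assms show ?thesis
    by (simp add: zero_prod_def)
next
  case 2
  then show ?thesis
    by (intro exI[of _ 0]) (simp add: omega_def)
next
  case 3
  then show ?thesis
    by (intro exI[of _ 1]) (simp add: omega_def)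
next
  case 4
  then show ?thesis
    by (intro exI[of _ 2]) (simp add: omega_def)
qed

lemma omega_sum: "omega 0 + omega 1 + omega 2 = 0"
  by (simp add: omega_def zero_prod_def)

lemma sum_UNIV_3: "sum f (UNIV :: 3 set) = f 0 + f 1 + f 2"
  unfolding UNIV_3 by (simp add: add.assoc)

text \<open>Representatives of the nine points of the Hermitian curve
  \<open>h(x, y) = x\<^sub>0 y\<^sub>1\<^sup>2 + x\<^sub>1 y\<^sub>0\<^sup>2 + x\<^sub>2 y\<^sub>2\<^sup>2\<close> in \<open>PG(2,4)\<close>, scaled such that \<open>(i, u) \<mapsto> \<omega>\<^sup>i hv u\<close>
  embeds the model of \<open>Q(5,2)\<close> on \<open>GF(3) \<times> GF(3)\<^sup>2\<close> into \<open>GF(4)\<^sup>3\<close>.\<close>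

definition hv :: "3 ^ 2 \<Rightarrow> 3 \<Rightarrow> bit \<times> bit" where
  "hv u r = (if u $ 0 = 0
     then (if r = 0 \<and> u $ 1 \<noteq> 1 \<or> r = 1 \<and> u $ 1 \<noteq> 0 then (1, 0) else (0, 0))
     else (if r = 0 then omega (u $ 0) else if r = 1 then (1, 0) else omega (u $ 0 * u $ 1)))"

text \<open>In GF(3) the map r \<mapsto> 1 - r swaps 0 and 1 and fixes 2, so the sum is the
  Hermitian form at \<open>hv u\<close>, evaluated at all nine points.\<close>

lemma hv_isotropic: "(\<Sum>r\<in>UNIV. hv u r \<odot> conj4 (hv u (1 - r))) = 0"
  by (cases "u $ 0" rule: cases_3; cases "u $ 1" rule: cases_3)
    (simp_all add: sum_UNIV_3 hv_def omega_def mul4_def conj4_def zero_prod_def)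

text \<open>The vectors of a line of the Q(5,2) model sum to zero, with the common factor
  \<open>omega i\<close> divided out; a finite check.\<close>

lemma hv_line:
  assumes "d \<noteq> 0"
  shows "hv u r + omega (\<Delta> u d) \<odot> hv (u + d) r + omega (2 * \<Delta> u d) \<odot> hv (u + 2 *s d) r = 0"
proof -
  have d: "d $ 0 \<noteq> 0 \<or> d $ 1 \<noteq> 0"
    using assms by (simp add: vec_2_eq_iff)
  show ?thesis
  proof (cases "u $ 0" rule: cases_3)
    case 1
    then show ?thesis using d
      by (cases "u $ 1" rule: cases_3; cases "d $ 0" rule: cases_3; cases "d $ 1" rule: cases_3;
          cases r rule: cases_3) (simp_all add: symp_def hv_def omega_def mul4_def zero_prod_def)
  next
    case 2
    then show ?thesis using d
      by (cases "u $ 1" rule: cases_3; cases "d $ 0" rule: cases_3; cases "d $ 1" rule: cases_3;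
          cases r rule: cases_3) (simp_all add: symp_def hv_def omega_def mul4_def zero_prod_def)
  next
    case 3
    then show ?thesis using d
      by (cases "u $ 1" rule: cases_3; cases "d $ 0" rule: cases_3; cases "d $ 1" rule: cases_3;
          cases r rule: cases_3) (simp_all add: symp_def hv_def omega_def mul4_def zero_prod_def)
  qed
qed

lemma hv_nonzero: "\<exists>r. hv u r \<noteq> 0"
proof -
  have "hv u 0 \<noteq> 0 \<or> hv u 1 \<noteq> 0"
    by (auto simp: hv_def omega_nonzero zero_prod_def)
  then show ?thesis
    by blast
qed

section \<open>Elementary tensors a (x \<otimes> y) in GF(4)^9 and the embedding of the glued
  hexagon\<close>

definition pure :: "bit \<times> bit \<Rightarrow> (3 \<Rightarrow> bit \<times> bit) \<Rightarrow> (3 \<Rightarrow> bit \<times> bit) \<Rightarrow> (bit \<times> bit) ^ (3 \<times> 3)" where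
  "pure a x y = (\<chi> p. a \<odot> (x (fst p) \<odot> y (snd p)))"

definition glued_vec :: "3 \<times> (3 ^ 2) \<times> (3 ^ 2) \<Rightarrow> (bit \<times> bit) ^ (3 \<times> 3)" where
  "glued_vec = (\<lambda>(i, u, v). pure (omega i) (hv u) (hv v))"

lemma glued_vec_nonzero: "glued_vec p \<noteq> 0"
proof -
  obtain i u v where p: "p = (i, u, v)"
    by (metis surj_pair)
  obtain r s where "hv u r \<noteq> 0" "hv v s \<noteq> 0"
    using hv_nonzero by blast
  then have "glued_vec p $ (r, s) \<noteq> 0"
    by (simp add: p glued_vec_def pure_def mul4_eq_0_iff omega_nonzero)
  then show ?thesis
    by auto
qed

lemma sum_range_3:
  assumes "card (range (f :: 3 \<Rightarrow> 'a)) = 3"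
  shows "sum g (range f) = g (f 0) + g (f 1) + g (f 2)"
proof -
  have "inj f"
    using assms by (intro eq_card_imp_inj_on) simp_all
  then show ?thesis
    by (simp add: sum.reindex sum_UNIV_3)
qed

lemma glued_vec_line:
  assumes "l \<in> lines Q52_glued_Q52"
  shows "sum glued_vec l = 0"
proof -
  have card: "card l = 3"
    using assms slim_dense_near_hexagon_glued by (auto simp: slim_dense_near_hexagon_def slim_def)
  \<comment> \<open>The tensor factor shared by the points of the line is pulled out, leaving the
    relation of \<open>hv_line\<close>.\<close>
  have A: "omega a \<odot> (x \<odot> y) + omega (a + b) \<odot> (x' \<odot> y) + omega (a + 2 * b) \<odot> (x'' \<odot> y) =
      omega a \<odot> ((x + omega b \<odot> x' + omega (2 * b) \<odot> x'') \<odot> y)" for a b x x' x'' y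
    by (simp add: omega_add mul4_add_left mul4_add_right mul4_assoc)
  have B: "omega a \<odot> (y \<odot> x) + omega (a + b) \<odot> (y \<odot> x') + omega (a + 2 * b) \<odot> (y \<odot> x'') =
      omega a \<odot> ((x + omega b \<odot> x' + omega (2 * b) \<odot> x'') \<odot> y)" for a b x x' x'' y
    using A[of a x y b x' x''] by (simp add: mul4_commute)
  from assms show ?thesis
  proof (cases l rule: glued_lines_cases)
    case (1 u v)
    have "omega 0 \<odot> x + omega 1 \<odot> x + omega 2 \<odot> x = 0" for x
      by (simp only: omega_sum mul4_add_left[symmetric] mul4_zero_left)
    with 1 card show ?thesis
      by (simp only: sum_range_3) (simp add: vec_eq_iff glued_vec_def pure_def)
  next
    case (2 i u v d)
    with card show ?thesis
      by (simp only: sum_range_3)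
        (simp add: vec_eq_iff glued_vec_def pure_def A hv_line mul4_zero_left mul4_zero_right)
  next
    case (3 i u v d)
    with card show ?thesis
      by (simp only: sum_range_3)
        (simp add: vec_eq_iff glued_vec_def pure_def B hv_line mul4_zero_left mul4_zero_right)
  qed
qed

lemma glued_line_common:
  assumes "l \<in> lines Q52_glued_Q52" "x \<in> l" "y \<in> l"
  shows "fst (snd x) = fst (snd y) \<or> snd (snd x) = snd (snd y)"
  using assms(1) by (cases l rule: glued_lines_cases) (use assms(2,3) in auto)

text \<open>\<open>T\<close> is closed under addition only; nonzero scalars are powers of \<omega>,
  which the coordinate \<open>i\<close> provides. Replacing one tensor factor at a time by a unit
  vector \<open>E k\<close> then reaches all axis vectors.\<close>

lemma glued_vec_span:
  assumes zero: "0 \<in> T" and vec: "\<And>p. glued_vec p \<in> T"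
    and add: "\<And>x y. x \<in> T \<Longrightarrow> y \<in> T \<Longrightarrow> x + y \<in> T"
  shows "T = UNIV"
proof -
  define E :: "3 \<Rightarrow> 3 \<Rightarrow> bit \<times> bit" where "E k r = (if r = k then (1, 0) else 0)" for k r
  define W where "W = range hv"
  have hv_T: "pure a x y \<in> T" if x: "x \<in> W" and y: "y \<in> W" for a x y
  proof (cases "a = 0")
    case True
    then have "pure a x y = 0"
      by (simp add: pure_def vec_eq_iff mul4_zero_left)
    then show ?thesis
      using zero by simp
  next
    case False
    then obtain i where "a = omega i"
      using omega_surj by blast
    then show ?thesis
      using vec x y by (auto simp: W_def glued_vec_def)
  qed
  \<comment> \<open>Three points whose vectors form a basis: two are unit vectors and the third is
    (\<omega>, 1, 1), so it yields \<open>E 2\<close>.\<close>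
  define u\<^sub>0 u\<^sub>1 u\<^sub>2 :: "3 ^ 2" where "u\<^sub>0 = 0" and "u\<^sub>1 = axis 1 1" and "u\<^sub>2 = axis 0 1"
  have "E 0 = hv u\<^sub>0" "E 1 = hv u\<^sub>1"
    by (auto simp: fun_eq_iff E_def hv_def u\<^sub>0_def u\<^sub>1_def axis_def zero_prod_def)
  then have EW: "E 0 \<in> W" "E 1 \<in> W" "hv u\<^sub>2 \<in> W"
    by (auto simp: W_def)
  have E2: "E 2 r = hv u\<^sub>2 r + omega 1 \<odot> E 0 r + E 1 r" for r
    by (cases r rule: cases_3)
      (simp_all add: E_def hv_def u\<^sub>2_def axis_def omega_def mul4_def zero_prod_def)
  have left: "pure a (E 2) y = pure a (hv u\<^sub>2) y + pure (a \<odot> omega 1) (E 0) y + pure a (E 1) y" for a y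
    by (simp add: pure_def vec_eq_iff E2 mul4_add_left mul4_add_right mul4_assoc)
  have right: "pure a x (E 2) = pure a x (hv u\<^sub>2) + pure (a \<odot> omega 1) x (E 0) + pure a x (E 1)" for a x
    by (simp add: pure_def vec_eq_iff E2 mul4_add_left mul4_add_right mul4_ac)
  have 1: "pure a (E k) y \<in> T" if "y \<in> W" for a k y
    using that EW hv_T add by (cases k rule: cases_3) (auto simp: left)
  have 2: "pure a (E k) (E l) \<in> T" for a k l
    using EW 1 add by (cases l rule: cases_3) (auto simp: right)
  have "pure a (E k) (E l) = axis (k, l) a" for a k l
    by (auto simp: vec_eq_iff pure_def E_def axis_def mul4_zero_left mul4_zero_right mul4_one_left
        mul4_one_right)
  then have axis_T: "axis p a \<in> T" for p a
    using 2 by (metis surj_pair)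
  have "x \<in> T" for x
    using sum_closed[of UNIV T "\<lambda>j. axis j (x $ j)"] zero add axis_T by (simp add: sum_axis)
  then show ?thesis
    by blast
qed

text \<open>The cocycle is \<open>Tr (\<omega> h)\<close> for the Hermitian form \<open>h\<close> on \<open>GF(4)\<^sup>9\<close>. Unlike other cocycles
  with the same commutator form it vanishes on the span of each line, so no signs are needed.\<close>

definition herm_cocycle :: "bit \<times> bit \<Rightarrow> bit \<times> bit \<Rightarrow> bit" where
  "herm_cocycle x y = snd (omega 1 \<odot> (x \<odot> conj4 y))"

lemma glued_representation:
  "\<exists>(R :: nat monoid) \<psi>. extra_special_minus 9 R \<and> nonabelian_representation Q52_glued_Q52 R \<psi>"
proof -
  obtain e :: "bit \<times> ((bit \<times> bit) ^ (3 \<times> 3)) \<Rightarrow> nat" where e: "inj e"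
    using finite_imp_inj_to_nat_seg[OF finite_class.finite_UNIV] by blast
  \<comment> \<open>The Hermitian form on each factor pairs index r with 1 - r; on the tensor
    product only (2, 2) is paired with itself.\<close>
  define \<sigma> :: "3 \<times> 3 \<Rightarrow> 3 \<times> 3" where "\<sigma> p = (1 - fst p, 1 - snd p)" for p
  interpret coordinate_cocycle herm_cocycle \<sigma> e
  proof
    show "herm_cocycle (p + p') q = herm_cocycle p q + herm_cocycle p' q" for p p' q
      by (simp only: herm_cocycle_def mul4_add_left mul4_add_right snd_add)
    show "herm_cocycle p (q + q') = herm_cocycle p q + herm_cocycle p q'" for p q q'
      by (simp only: herm_cocycle_def mul4_add_right conj4_add snd_add)
    show "herm_cocycle (1, 0) (0, 1) \<noteq> herm_cocycle (0, 1) (1, 0)"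
      by (simp add: herm_cocycle_def omega_def mul4_def conj4_def)
  qed (auto simp: \<sigma>_def e)
  have "extra_special_minus CARD(3 \<times> 3) G"
  proof (rule extra_special_minus_G)
    \<comment> \<open>Both 1 and \<omega> have norm 1, and \<omega> has trace 1, so the fixed
      coordinate gives the quaternion factor.\<close>
    show "herm_cocycle (1, 0) (1, 0) = 1" "herm_cocycle (0, 1) (0, 1) = 1"
      by (simp_all add: herm_cocycle_def omega_def mul4_def conj4_def)
    have "1 - r = r \<longleftrightarrow> r = 2" for r :: 3
      by (cases r rule: cases_3) simp_all
    then show "\<sigma> p = p \<longleftrightarrow> p = (2, 2)" for p
      by (simp add: \<sigma>_def prod_eq_iff)
  qed
  then have minus: "extra_special_minus 9 G"
    by simp
  \<comment> \<open>On elementary tensors \<open>\<beta>\<close> is the trace of \<omega> a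
    \<open>conj4 b\<close> h(x, x') h(y, y'), so one vanishing factor suffices.\<close>
  have perp: "\<beta> (pure a x y) (pure b x' y') = 0"
    if "(\<Sum>r\<in>UNIV. x r \<odot> conj4 (x' (1 - r))) = 0 \<or> (\<Sum>r\<in>UNIV. y r \<odot> conj4 (y' (1 - r))) = 0" for a b x y x' y'
  proof -
    let ?A = "\<lambda>r. x r \<odot> conj4 (x' (1 - r))" and ?B = "\<lambda>r. y r \<odot> conj4 (y' (1 - r))"
    have "\<beta> (pure a x y) (pure b x' y') =
        (\<Sum>p\<in>UNIV. snd (omega 1 \<odot> (a \<odot> conj4 b) \<odot> (?A (fst p) \<odot> ?B (snd p))))"
      unfolding \<beta>_def
      by (rule sum.cong) (simp_all add: pure_def herm_cocycle_def \<sigma>_def conj4_mul4 mul4_ac)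
    also have "\<dots> = snd (omega 1 \<odot> (a \<odot> conj4 b) \<odot> (\<Sum>p\<in>UNIV. ?A (fst p) \<odot> ?B (snd p)))"
      by (simp add: snd_sum mul4_sum_right)
    also have "(\<Sum>p\<in>UNIV. ?A (fst p) \<odot> ?B (snd p)) = (\<Sum>r\<in>UNIV. \<Sum>s\<in>UNIV. ?A r \<odot> ?B s)"
      by (simp add: sum.cartesian_product case_prod_beta)
    also have "\<dots> = (\<Sum>r\<in>UNIV. ?A r) \<odot> (\<Sum>s\<in>UNIV. ?B s)"
      unfolding mul4_sum_left by (simp only: mul4_sum_right)
    also have "\<dots> = 0"
      using that by (auto simp only: mul4_zero_left mul4_zero_right)
    finally show ?thesis
      by (simp add: mul4_zero_right)
  qed
  have perp': "\<beta> (glued_vec p) (glued_vec q) = 0"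
    if "fst (snd p) = fst (snd q) \<or> snd (snd p) = snd (snd q)" for p q
  proof -
    obtain i u v j u' v' where pq: "p = (i, u, v)" "q = (j, u', v')"
      by (metis surj_pair)
    then have "u = u' \<or> v = v'"
      using that by simp
    then show ?thesis
      unfolding pq glued_vec_def prod.case using hv_isotropic by (intro perp) blast
  qed
  have "nonabelian_representation Q52_glued_Q52 G (\<lambda>p. e (0, glued_vec p))"
  proof (rule nonabelian_representationI)
    show "glued_vec p \<noteq> 0 \<and> \<beta> (glued_vec p) (glued_vec p) = 0" for p
      using glued_vec_nonzero perp' by blast
    show "{x, y, z} \<subseteq> points Q52_glued_Q52 \<and> glued_vec x + glued_vec y = glued_vec z \<and>
        \<beta> (glued_vec x) (glued_vec y) = 0"
      if "distinct [x, y, z]" "{x, y, z} \<in> lines Q52_glued_Q52" for x y z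
    proof (intro conjI)
      show "{x, y, z} \<subseteq> points Q52_glued_Q52"
        by (simp add: Q52_glued_Q52_def)
      have "glued_vec x + (glued_vec y + glued_vec z) = 0"
        using glued_vec_line[OF that(2)] that(1) by simp
      then have "glued_vec x + glued_vec y + glued_vec z = glued_vec z + glued_vec z"
        by (simp only: add_self add.assoc)
      then show "glued_vec x + glued_vec y = glued_vec z"
        by (simp only: add_right_cancel)
      show "\<beta> (glued_vec x) (glued_vec y) = 0"
        using glued_line_common[OF that(2), of x y] perp' by blast
    qed
    show "T = UNIV" if "0 \<in> T" "\<And>p. p \<in> points Q52_glued_Q52 \<Longrightarrow> glued_vec p \<in> T"
      "\<And>x y. x \<in> T \<Longrightarrow> y \<in> T \<Longrightarrow> x + y \<in> T" for T
      using that(1) _ that(3) by (rule glued_vec_span) (auto intro: that(2) simp: Q52_glued_Q52_def)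
  qed
  with minus show ?thesis
    by blast
qed

section \<open>The quadric \<open>Q(5,2)\<close>\<close>

text \<open>The needed incidence properties of \<open>Q(5,2)\<close> are checked on the 27 points, written as
  bit strings.\<close>

type_synonym bits6 = "bool \<times> bool \<times> bool \<times> bool \<times> bool \<times> bool"

text \<open>Over GF(2) the anisotropic part s^2 + s t + t^2 is the disjunction of \<open>s\<close>
  and \<open>t\<close>.\<close>

fun form6 :: "bits6 \<Rightarrow> bool" where
  "form6 (a, b, c, d, s, t) \<longleftrightarrow> ((a \<and> b) \<noteq> (c \<and> d)) \<noteq> (s \<or> t)"

fun polar6 :: "bits6 \<Rightarrow> bits6 \<Rightarrow> bool" where
  "polar6 (a, b, c, d, s, t) (a', b', c', d', s', t') \<longleftrightarrow>
    ((((((a \<and> b') \<noteq> (b \<and> a')) \<noteq> (c \<and> d')) \<noteq> (d \<and> c')) \<noteq> (s \<and> t')) \<noteq> (t \<and> s'))"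

fun xor6 :: "bits6 \<Rightarrow> bits6 \<Rightarrow> bits6" where
  "xor6 (a, b, c, d, s, t) (a', b', c', d', s', t') =
    (a \<noteq> a', b \<noteq> b', c \<noteq> c', d \<noteq> d', s \<noteq> s', t \<noteq> t')"

definition all6 :: "bits6 list" where
  "all6 = (let b = [False, True] in
    List.product b (List.product b (List.product b (List.product b (List.product b b)))))"

definition points6 :: "bits6 list" where
  "points6 = filter (\<lambda>x. \<not> form6 x \<and> x \<noteq> (False, False, False, False, False, False)) all6"

lemma set_all6: "set all6 = UNIV"
proof -
  have "set [False, True] = UNIV"
    by auto
  then show ?thesis
    unfolding all6_def Let_def by (simp only: set_product UNIV_Times_UNIV)
qed

lemma length_points6: "length points6 = 27"
  by code_simp

lemma distinct_points6: "distinct points6"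
  by code_simp

text \<open>The polarisation identity on singular vectors: both individual values of the quadratic
  form vanish.\<close>

lemma form6_xor_points6:
  "list_all (\<lambda>x. list_all (\<lambda>y. form6 (xor6 x y) = polar6 x y) points6) points6"
  by code_simp

text \<open>Every point lies on two different lines: \<open>z'\<close> is collinear with
  \<open>x\<close> but off the line through \<open>x\<close> and \<open>z\<close>.\<close>

lemma two_lines_points6:
  "list_all (\<lambda>x. list_ex (\<lambda>z. z \<noteq> x \<and> \<not> polar6 x z \<and>
     list_ex (\<lambda>z'. z' \<noteq> x \<and> z' \<noteq> z \<and> z' \<noteq> xor6 x z \<and> \<not> polar6 x z') points6) points6) points6"
  by code_simp

text \<open>The elliptic quadric has Witt index 2, so three pairwise perpendicular points lie on one
  line.\<close>

lemma no_singular_plane_points6: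
  "list_all (\<lambda>p. let P = filter (\<lambda>x. x \<noteq> p \<and> \<not> polar6 p x) points6 in
     list_all (\<lambda>x. list_all (\<lambda>y. x = y \<or> polar6 x y \<or> p = xor6 x y) P) P) points6"
  by code_simp

text \<open>This makes the points span GF(2)^6; it serves the generation condition (R1).\<close>

lemma sums_points6:
  "list_all (\<lambda>x. list_ex (\<lambda>y. list_ex (\<lambda>z. x = xor6 y z) points6) points6) all6"
  by code_simp

section \<open>Transfer from bit strings to \<open>bit ^ 6\<close>\<close>

lemma UNIV_6: "(UNIV :: 6 set) = {0, 1, 2, 3, 4, 5}"
  by (rule card_subset_eq[symmetric]) auto

lemma all_6: "(\<forall>k::6. P k) \<longleftrightarrow> P 0 \<and> P 1 \<and> P 2 \<and> P 3 \<and> P 4 \<and> P 5"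
  using UNIV_6 by (metis UNIV_I empty_iff insert_iff)

lemma sum_UNIV_6: "sum f (UNIV :: 6 set) = f 0 + f 1 + f 2 + f 3 + f 4 + f 5"
  unfolding UNIV_6 by (simp add: add.assoc)

fun vec6 :: "bits6 \<Rightarrow> bit ^ 6" where
  "vec6 (a, b, c, d, s, t) = (\<chi> i. of_bool (if i = 0 then a else if i = 1 then b else if i = 2 then c
     else if i = 3 then d else if i = 4 then s else t))"

declare form6.simps [simp del] polar6.simps [simp del] xor6.simps [simp del] vec6.simps [simp del]

text \<open>The pairing of coordinates in the polar form. Squares disappear under polarisation, so
  the anisotropic pair 4, 5 behaves like the hyperbolic ones.\<close>

definition swap6 :: "6 \<Rightarrow> 6" where
  "swap6 i = (if i = 0 then 1 else if i = 1 then 0 else if i = 2 then 3 else if i = 3 then 2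
     else if i = 4 then 5 else 4)"

definition polar :: "bit ^ 6 \<Rightarrow> bit ^ 6 \<Rightarrow> bit" where
  "polar x y = (\<Sum>i\<in>UNIV. x $ i * y $ swap6 i)"

lemma of_bool_bit: "of_bool a + of_bool b = (of_bool (a \<noteq> b) :: bit)"
  "of_bool a * of_bool b = (of_bool (a \<and> b) :: bit)"
  by (cases a; cases b; simp)+

lemma of_bool_bit_eq: "of_bool a = (0 :: bit) \<longleftrightarrow> \<not> a" "of_bool a = (of_bool b :: bit) \<longleftrightarrow> a = b"
  by (cases a; cases b; simp)+

lemma vec6_nth:
  "vec6 (a, b, c, d, s, t) $ 0 = of_bool a" "vec6 (a, b, c, d, s, t) $ 1 = of_bool b"
  "vec6 (a, b, c, d, s, t) $ 2 = of_bool c" "vec6 (a, b, c, d, s, t) $ 3 = of_bool d"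
  "vec6 (a, b, c, d, s, t) $ 4 = of_bool s" "vec6 (a, b, c, d, s, t) $ 5 = of_bool t"
  by (simp_all add: vec6.simps)

lemma vec6_add: "vec6 x + vec6 y = vec6 (xor6 x y)"
  by (cases x; cases y)
    (simp only: vec_eq_iff all_6 xor6.simps vector_add_component vec6_nth of_bool_bit simp_thms)

lemma vec6_eq_iff: "vec6 x = vec6 y \<longleftrightarrow> x = y"
  by (cases x; cases y)
    (simp only: vec_eq_iff all_6 vec6_nth of_bool_bit_eq prod.inject)

lemma vec6_surj: "\<exists>t. x = vec6 t"
proof -
  have *: "of_bool (b = 1) = b" for b :: bit
    by (cases b) simp_all
  have "x = vec6 (x $ 0 = 1, x $ 1 = 1, x $ 2 = 1, x $ 3 = 1, x $ 4 = 1, x $ 5 = 1)"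
    by (simp only: vec_eq_iff all_6 vec6_nth * simp_thms)
  then show ?thesis ..
qed

lemma elliptic_form_vec6: "elliptic_form (vec6 x) = of_bool (form6 x)"
proof (cases x)
  case (fields a b c d s t)
  have "elliptic_form (vec6 x) =
      of_bool (((((a \<and> b) \<noteq> (c \<and> d)) \<noteq> (s \<and> s)) \<noteq> (s \<and> t)) \<noteq> (t \<and> t))"
    by (simp only: fields elliptic_form_def vec6_nth power2_eq_square of_bool_bit)
  also have "\<dots> = of_bool (form6 x)"
    unfolding fields form6.simps by (cases s; cases t; simp)
  finally show ?thesis .
qed

lemma polar_vec6: "polar (vec6 x) (vec6 y) = of_bool (polar6 x y)"
proof (cases x; cases y)
  fix a b c d s t a' b' c' d' s' t'
  assume x: "x = (a, b, c, d, s, t)" and y: "y = (a', b', c', d', s', t')"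
  have sw: "swap6 0 = 1" "swap6 1 = 0" "swap6 2 = 3" "swap6 3 = 2" "swap6 4 = 5" "swap6 5 = 4"
    by (simp_all add: swap6_def)
  show ?thesis
    by (simp only: x y polar_def sum_UNIV_6 sw vec6_nth of_bool_bit polar6.simps)
qed

lemma vec6_zero: "vec6 (False, False, False, False, False, False) = 0"
  by (simp only: vec_eq_iff all_6 vec6_nth zero_index of_bool_eq simp_thms)

lemma Q52_points_eq: "Q52_points = vec6 ` set points6"
proof -
  have "vec6 t \<in> Q52_points \<longleftrightarrow> t \<in> set points6" for t
    unfolding Q52_points_def points6_def
    by (simp only: mem_Collect_eq elliptic_form_vec6 of_bool_bit_eq set_filter set_all6
        vec6_zero[symmetric] vec6_eq_iff) blast
  then have *: "vec6 t \<in> Q52_points \<longleftrightarrow> vec6 t \<in> vec6 ` set points6" for t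
    by (simp only: image_iff vec6_eq_iff) blast
  show ?thesis
  proof (rule Set.set_eqI)
    fix x
    obtain t where "x = vec6 t"
      using vec6_surj by blast
    then show "x \<in> Q52_points \<longleftrightarrow> x \<in> vec6 ` set points6"
      by (simp only: *)
  qed
qed

lemma card_Q52_points: "card Q52_points = 27"
  unfolding Q52_points_eq
  using distinct_card[OF distinct_points6] length_points6
  by (subst card_image) (simp_all add: inj_on_def vec6_eq_iff)

section \<open>Perpendicularity and collinearity on the quadric\<close>

lemma polar_add_right: "polar p (x + y) = polar p x + polar p y"
  unfolding polar_def by (simp only: vector_add_component distrib_left sum.distrib)

lemma polar_add_left: "polar (x + y) p = polar x p + polar y p"
  unfolding polar_def by (simp only: vector_add_component distrib_right sum.distrib)

lemma polar_commute: "polar x y = polar y x"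
proof -
  have sw: "swap6 0 = 1" "swap6 1 = 0" "swap6 2 = 3" "swap6 3 = 2" "swap6 4 = 5" "swap6 5 = 4"
    by (simp_all add: swap6_def)
  show ?thesis
    by (simp only: polar_def sum_UNIV_6 sw ac_simps)
qed

lemma vec_bit_add_self: "(x :: bit ^ 'n) + x = 0"
  by (simp add: vec_eq_iff)

lemma polar_self: "polar x x = 0"
proof -
  obtain t where "x = vec6 t"
    using vec6_surj by blast
  moreover have "\<not> polar6 t t"
    by (cases t) (simp add: polar6.simps conj_commute)
  ultimately show ?thesis
    by (simp add: polar_vec6)
qed

lemma add_in_Q52_points_iff:
  assumes "x \<in> Q52_points" "y \<in> Q52_points" "x \<noteq> y"
  shows "x + y \<in> Q52_points \<longleftrightarrow> polar x y = 0"
proof -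
  obtain s t where st: "x = vec6 s" "y = vec6 t" "s \<in> set points6" "t \<in> set points6"
    using assms by (auto simp: Q52_points_eq)
  then have "form6 (xor6 s t) = polar6 s t"
    using form6_xor_points6 unfolding list_all_iff by blast
  moreover have "x + y \<noteq> 0"
    using assms(3) vec_bit_add_self[of y] by (metis add_right_cancel)
  ultimately show ?thesis
    by (simp add: Q52_points_def st(1,2) vec6_add elliptic_form_vec6 polar_vec6 of_bool_bit_eq)
qed

lemma no_singular_plane:
  assumes "p \<in> Q52_points" "x \<in> Q52_points" "y \<in> Q52_points"
    and "x \<noteq> y" "polar p x = 0" "polar p y = 0" "polar x y = 0"
  shows "p \<in> {x, y, x + y}"
proof -
  obtain r s t where rst: "p = vec6 r" "x = vec6 s" "y = vec6 t"
    "r \<in> set points6" "s \<in> set points6" "t \<in> set points6"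
    using assms by (auto simp: Q52_points_eq)
  have "s \<noteq> t" "\<not> polar6 r s" "\<not> polar6 r t" "\<not> polar6 s t"
    using assms(4-) unfolding rst(1-3) polar_vec6 vec6_eq_iff of_bool_bit_eq .
  then have "r = s \<or> r = t \<or> r = xor6 s t"
    using no_singular_plane_points6 rst(4-)
    unfolding list_all_iff Let_def set_filter mem_Collect_eq by blast
  then show ?thesis
    unfolding rst(1-3) vec6_add insert_iff vec6_eq_iff by blast
qed

lemma two_lines:
  assumes "x \<in> Q52_points"
  obtains z z' where "z \<in> Q52_points" "z' \<in> Q52_points" "z \<noteq> x" "z' \<noteq> x" "z' \<noteq> z" "z' \<noteq> x + z"
    "polar x z = 0" "polar x z' = 0"
proof -
  obtain s where s: "x = vec6 s" "s \<in> set points6"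
    using assms by (auto simp: Q52_points_eq)
  then obtain t t' where t: "t \<in> set points6" "t' \<in> set points6" "t \<noteq> s" "t' \<noteq> s" "t' \<noteq> t"
    "t' \<noteq> xor6 s t" "\<not> polar6 s t" "\<not> polar6 s t'"
    using two_lines_points6 unfolding list_all_iff list_ex_iff by blast
  show ?thesis
    by (rule that[of "vec6 t" "vec6 t'"])
      (use t in \<open>simp_all only: s(1) Q52_points_eq imageI vec6_add vec6_eq_iff polar_vec6 of_bool_bit_eq simp_thms\<close>)
qed

lemma sum_of_two_points: "\<exists>y\<in>Q52_points. \<exists>z\<in>Q52_points. x = y + z"
proof -
  obtain t where x: "x = vec6 t"
    using vec6_surj by blast
  have "t \<in> set all6"
    by (simp add: set_all6)
  then obtain r s where "r \<in> set points6" "s \<in> set points6" "t = xor6 r s"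
    using sums_points6 unfolding list_all_iff list_ex_iff by blast
  then show ?thesis
    unfolding x Q52_points_eq by (metis imageI vec6_add)
qed

lemma common_neighbours:
  assumes x: "x \<in> Q52_points" and y: "y \<in> Q52_points" and "polar x y \<noteq> 0"
  obtains a b where "a \<in> Q52_points" "b \<in> Q52_points" "a \<noteq> b" "polar x a = 0" "polar a y = 0"
    "polar x b = 0" "polar b y = 0"
proof -
  obtain z z' where z: "z \<in> Q52_points" "z' \<in> Q52_points" "z \<noteq> y" "z' \<noteq> y" "z' \<noteq> z" "z' \<noteq> y + z"
    "polar y z = 0" "polar y z' = 0"
    using two_lines[OF y] by blast
  \<comment> \<open>A line on \<open>y\<close> has a unique point perpendicular to \<open>x\<close>.\<close>
  have perp: "\<exists>a\<in>{w, y + w}. a \<in> Q52_points \<and> polar x a = 0 \<and> polar a y = 0"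
    if w: "w \<in> Q52_points" "w \<noteq> y" "polar y w = 0" for w
  proof (cases "polar x w = 0")
    case True
    then show ?thesis
      using w polar_commute by auto
  next
    case False
    then have "polar x (y + w) = 0"
      using assms(3) by (simp add: polar_add_right)
    moreover have "polar (y + w) y = 0"
      using w polar_commute[of w y] by (simp add: polar_add_left polar_self)
    moreover have "y + w \<in> Q52_points"
      using add_in_Q52_points_iff[OF y w(1)] w by auto
    ultimately show ?thesis
      by blast
  qed
  obtain a where a: "a \<in> {z, y + z}" "a \<in> Q52_points" "polar x a = 0" "polar a y = 0"
    using perp z by blast
  obtain b where b: "b \<in> {z', y + z'}" "b \<in> Q52_points" "polar x b = 0" "polar b y = 0"
    using perp z by blast
  \<comment> \<open>\<open>z'\<close> is off the line through \<open>y\<close> and \<open>z\<close>,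
    so the two candidate sets are disjoint.\<close>
  have "y + (y + z) = z" "y + (y + z') = z'"
    using vec_bit_add_self[of y] by (simp_all only: add.assoc[symmetric] add_0)
  then have "a \<noteq> b"
    using a(1) b(1) z(5,6) by auto
  then show ?thesis
    using that a b by blast
qed

section \<open>The near hexagon \<open>Q(5,2) \<times> L\<^sub>3\<close> and its representation\<close>

definition quadric_dist :: "bit ^ 6 \<Rightarrow> bit ^ 6 \<Rightarrow> nat" where
  "quadric_dist x y = (if x = y then 0 else if polar x y = 0 then 1 else 2)"

lemma Q52_lines_cases:
  assumes "l \<in> lines Q52"
  obtains x y where "l = {x, y, x + y}" "x \<in> Q52_points" "y \<in> Q52_points" "x + y \<in> Q52_points"
    "x \<noteq> y" "x + y \<noteq> x" "x + y \<noteq> y" "polar x y = 0"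
proof -
  obtain x y where l: "l = {x, y, x + y}" "x \<noteq> y" and P: "{x, y, x + y} \<subseteq> Q52_points"
    using assms by (auto simp: Q52_def)
  then have "x + y \<noteq> x" "x + y \<noteq> y"
    by (auto simp: Q52_points_def)
  moreover have "polar x y = 0"
    using add_in_Q52_points_iff[of x y] l P by auto
  ultimately show ?thesis
    using that l P by blast
qed

lemma Q52_line_third:
  assumes "l \<in> lines Q52" "a \<in> l" "b \<in> l" "a \<noteq> b"
  shows "l = {a, b, a + b}" "polar a b = 0"
proof -
  obtain x y where l: "l = {x, y, x + y}" "polar x y = 0"
    using Q52_lines_cases[OF assms(1)] by metis
  have *: "x + (x + y) = y" "y + (x + y) = x" "x + y + x = y" "x + y + y = x" "y + x = x + y"
    using vec_bit_add_self[of x] vec_bit_add_self[of y] by (metis add.assoc add.commute add_0)+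
  have p: "polar y x = 0" "polar x (x + y) = 0" "polar y (x + y) = 0" "polar (x + y) x = 0"
    "polar (x + y) y = 0"
    using l(2) polar_commute[of y x] by (simp_all add: polar_add_left polar_add_right polar_self)
  consider "a = x \<and> b = y" | "a = y \<and> b = x" | "a = x \<and> b = x + y" | "a = x + y \<and> b = x"
    | "a = y \<and> b = x + y" | "a = x + y \<and> b = y"
    using assms(2-4) unfolding l(1) by blast
  then have "l = {a, b, a + b} \<and> polar a b = 0"
    by cases (simp_all only: l p * simp_thms insert_commute)
  then show "l = {a, b, a + b}" "polar a b = 0"
    by simp_all
qed

text \<open>The generalized quadrangle axiom: \<open>polar p\<close> is linear on the line and, for
  \<open>p\<close> off the line, not identically zero because there is no singular plane; hence it
  has exactly one zero there.\<close>

lemma Q52_gate: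
  assumes p: "p \<in> Q52_points" and l: "l \<in> lines Q52"
  shows "\<exists>q\<in>l. \<forall>r\<in>l. r \<noteq> q \<longrightarrow> quadric_dist p r = Suc (quadric_dist p q)"
proof (cases "p \<in> l")
  case True
  then show ?thesis
    using Q52_line_third(2)[OF l True] by (intro bexI[of _ p]) (auto simp: quadric_dist_def)
next
  case False
  obtain x y where xy: "l = {x, y, x + y}" "x \<in> Q52_points" "y \<in> Q52_points" "x \<noteq> y" "polar x y = 0"
    using Q52_lines_cases[OF l] by metis
  have "\<not> (polar p x = 0 \<and> polar p y = 0)"
    using no_singular_plane[OF p xy(2-4)] xy False by blast
  then consider "polar p x = 0" "polar p y = 1" "polar p (x + y) = 1"
    | "polar p x = 1" "polar p y = 0" "polar p (x + y) = 1"
    | "polar p x = 1" "polar p y = 1" "polar p (x + y) = 0"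
    unfolding polar_add_right by (cases "polar p x"; cases "polar p y") auto
  then obtain q where "q \<in> l" "polar p q = 0" "\<forall>r\<in>l. r \<noteq> q \<longrightarrow> polar p r \<noteq> 0"
    by cases (auto simp: xy(1))
  moreover have "p \<noteq> r" if "r \<in> l" for r
    using that False by blast
  ultimately show ?thesis
    by (intro bexI[of _ q]) (auto simp: quadric_dist_def)
qed

section \<open>Lines and distances of the product with L_3\<close>

lemma points_times_L3: "points (times_L3 Q52) = Q52_points \<times> {0, 1, 2}"
  by (simp add: times_L3_def Q52_def)

lemma times_L3_lines_cases:
  assumes "k \<in> lines (times_L3 S)"
  obtains l i where "k = l \<times> {i}" "l \<in> lines S" "i \<in> {0, 1, 2}"
  | x where "k = {(x, 0), (x, 1), (x, 2)}" "x \<in> points S"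
proof -
  have "(\<exists>l i. k = l \<times> {i} \<and> l \<in> lines S \<and> i \<in> {0, 1, 2}) \<or> (\<exists>x. k = {x} \<times> {0, 1, 2} \<and> x \<in> points S)"
    using assms unfolding times_L3_def snd_conv by blast
  moreover have "{x} \<times> {0, 1, 2 :: nat} = {(x, 0), (x, 1), (x, 2)}" for x :: 'a
    by auto
  ultimately show ?thesis
    using that by metis
qed

lemma collinearityI: "\<lbrakk>l \<in> lines S; x \<in> l; y \<in> l; x \<noteq> y\<rbrakk> \<Longrightarrow> (x, y) \<in> collinearity S"
  by (auto simp: collinearity_def)

lemma collinear_times_L3:
  assumes "x \<in> Q52_points" "y \<in> Q52_points" "x \<noteq> y" "polar x y = 0" "i \<in> {0, 1, 2}"
  shows "((x, i), (y, i)) \<in> collinearity (times_L3 Q52)"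
proof -
  have "x + y \<in> Q52_points"
    using assms add_in_Q52_points_iff by blast
  then have "{x, y, x + y} \<in> lines Q52"
    using assms unfolding Q52_def snd_conv by blast
  then have l: "{x, y, x + y} \<times> {i} \<in> lines (times_L3 Q52)"
    using assms(5) unfolding times_L3_def snd_conv by blast
  show ?thesis
    by (rule collinearityI[OF l]) (use assms(3) in auto)
qed

lemma collinear_times_L3_fibre:
  assumes "x \<in> Q52_points" "i \<in> {0, 1, 2}" "j \<in> {0, 1, 2}" "i \<noteq> j"
  shows "((x, i), (x, j)) \<in> collinearity (times_L3 Q52)"
proof -
  have l: "{x} \<times> {0, 1, 2} \<in> lines (times_L3 Q52)"
    using assms(1) unfolding times_L3_def Q52_def fst_conv snd_conv by blast
  show ?thesis
    by (rule collinearityI[OF l]) (use assms(2-4) in auto)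
qed

definition L3_dist :: "(bit ^ 6) \<times> nat \<Rightarrow> (bit ^ 6) \<times> nat \<Rightarrow> nat" where
  "L3_dist p q = quadric_dist (fst p) (fst q) + of_bool (snd p \<noteq> snd q)"

lemma L3_dist_step:
  assumes "p \<in> points (times_L3 Q52)" "q \<in> points (times_L3 Q52)" "p \<noteq> q"
  shows "\<exists>r. (r, q) \<in> collinearity (times_L3 Q52) \<and> L3_dist p q = Suc (L3_dist p r)"
proof -
  obtain x i y j where pq: "p = (x, i)" "q = (y, j)" "x \<in> Q52_points" "y \<in> Q52_points"
    and ij: "i \<in> {0, 1, 2}" "j \<in> {0, 1, 2}"
    using assms unfolding points_times_L3 by blast
  show ?thesis
  proof (cases "i = j")
    case False
    then show ?thesis
      using collinear_times_L3_fibre[OF pq(4) ij False]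
      by (intro exI[of _ "(y, i)"]) (simp add: pq L3_dist_def)
  next
    case True
    then have "x \<noteq> y"
      using assms(3) pq by simp
    show ?thesis
    proof (cases "polar x y = 0")
      case perp: True
      then show ?thesis
        using collinear_times_L3[OF pq(3,4) \<open>x \<noteq> y\<close> perp ij(1)] True \<open>x \<noteq> y\<close>
        by (intro exI[of _ "(x, i)"]) (simp add: pq L3_dist_def quadric_dist_def)
    next
      case False
      then obtain a where a: "a \<in> Q52_points" "polar x a = 0" "polar a y = 0"
        using common_neighbours[OF pq(3,4)] by metis
      then have "a \<noteq> y" "a \<noteq> x"
        using False by auto
      then show ?thesis
        using collinear_times_L3[OF a(1) pq(4) \<open>a \<noteq> y\<close> a(3) ij(1)] True \<open>x \<noteq> y\<close> a False
        by (intro exI[of _ "(a, i)"]) (auto simp: pq L3_dist_def quadric_dist_def)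
    qed
  qed
qed

text \<open>In different layers the two points are opposite corners of a grid quadrangle; in the
  same layer the neighbours come from the quadric.\<close>

lemma L3_dist_dense:
  assumes "p \<in> points (times_L3 Q52)" "q \<in> points (times_L3 Q52)" "L3_dist p q = 2"
  shows "\<exists>a b. a \<noteq> b \<and> {(p, a), (a, q), (p, b), (b, q)} \<subseteq> collinearity (times_L3 Q52)"
proof -
  obtain x i y j where pq: "p = (x, i)" "q = (y, j)" "x \<in> Q52_points" "y \<in> Q52_points"
    and ij: "i \<in> {0, 1, 2}" "j \<in> {0, 1, 2}"
    using assms unfolding points_times_L3 by blast
  show ?thesis
  proof (cases "i = j")
    case False
    then have "x \<noteq> y" "polar x y = 0"
      using assms(3) by (auto simp: pq L3_dist_def quadric_dist_def split: if_splits)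
    then have "{(p, (x, j)), ((x, j), q), (p, (y, i)), ((y, i), q)} \<subseteq> collinearity (times_L3 Q52)"
      using collinear_times_L3[OF pq(3,4)] collinear_times_L3_fibre[OF _ ij False] ij pq by auto
    then show ?thesis
      using False by (intro exI[of _ "(x, j)"] exI[of _ "(y, i)"]) auto
  next
    case True
    then have "polar x y \<noteq> 0"
      using assms(3) by (auto simp: pq L3_dist_def quadric_dist_def split: if_splits)
    then obtain a b where ab: "a \<in> Q52_points" "b \<in> Q52_points" "a \<noteq> b" "polar x a = 0" "polar a y = 0"
      "polar x b = 0" "polar b y = 0"
      using common_neighbours[OF pq(3,4)] by metis
    then have "a \<noteq> x" "a \<noteq> y" "b \<noteq> x" "b \<noteq> y"
      using \<open>polar x y \<noteq> 0\<close> by auto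
    then have "{(p, (a, i)), ((a, i), q), (p, (b, i)), ((b, i), q)} \<subseteq> collinearity (times_L3 Q52)"
      using ab pq ij(1) True by (auto intro!: collinear_times_L3 simp del: insert_iff)
    then show ?thesis
      using ab(3) by (intro exI[of _ "(a, i)"] exI[of _ "(b, i)"]) auto
  qed
qed

text \<open>For a line inside a layer the layer term is constant and the gate of the quadric is
  used; on a fibre the gate is the point in the layer of \<open>p\<close>.\<close>

lemma L3_gate:
  assumes "p \<in> points (times_L3 Q52)" "k \<in> lines (times_L3 Q52)"
  shows "\<exists>q\<in>k. \<forall>r\<in>k. r \<noteq> q \<longrightarrow> L3_dist p r = Suc (L3_dist p q)"
proof -
  obtain x i where p: "p = (x, i)" "x \<in> Q52_points" "i \<in> {0, 1, 2}"
    using assms unfolding points_times_L3 by blast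
  from assms(2) show ?thesis
  proof (cases k rule: times_L3_lines_cases)
    case (1 l j)
    obtain q where "q \<in> l" "\<forall>r\<in>l. r \<noteq> q \<longrightarrow> quadric_dist x r = Suc (quadric_dist x q)"
      using Q52_gate[OF p(2) 1(2)] by blast
    then show ?thesis
      by (intro bexI[of _ "(q, j)"]) (auto simp: p(1) 1(1) L3_dist_def)
  next
    case (2 y)
    then show ?thesis
      using p(3) by (intro bexI[of _ "(y, i)"]) (auto simp: p(1) L3_dist_def)
  qed
qed

lemma times_L3_line:
  assumes "k \<in> lines (times_L3 Q52)"
  shows "k \<subseteq> points (times_L3 Q52) \<and> card k = 3"
  using assms
proof (cases k rule: times_L3_lines_cases)
  case (1 l i)
  then obtain x y where "l = {x, y, x + y}" "x \<in> Q52_points" "y \<in> Q52_points" "x + y \<in> Q52_points"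
    "x \<noteq> y" "x + y \<noteq> x" "x + y \<noteq> y"
    using Q52_lines_cases[OF 1(2)] by metis
  then have "l \<subseteq> Q52_points" "card l = 3"
    by (auto simp: card_3_iff)
  then show ?thesis
    using 1 by (auto simp: points_times_L3 card_cartesian_product)
next
  case (2 x)
  then show ?thesis
    unfolding points_times_L3 by (simp add: Q52_def)
qed

text \<open>The third layer of a fibre is \<open>3 - i - j\<close>, as the layers 0, 1, 2 add up to
  3. Distance 3 is attained by non-perpendicular points in different layers.\<close>

lemma slim_dense_near_hexagon_times_L3: "slim_dense_near_hexagon (times_L3 Q52)"
proof (rule slim_dense_near_hexagonI[where D = L3_dist
      and t = "\<lambda>p q. if snd p = snd q then (fst p + fst q, snd p) else (fst p, 3 - snd p - snd q)"])
  show "k \<subseteq> points (times_L3 Q52) \<and> card k = 3" if "k \<in> lines (times_L3 Q52)" for k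
    using that by (rule times_L3_line)
  show "k = {p, q, if snd p = snd q then (fst p + fst q, snd p) else (fst p, 3 - snd p - snd q)}"
    if k: "k \<in> lines (times_L3 Q52)" and pq: "p \<in> k" "q \<in> k" "p \<noteq> q" for k p q
    using k
  proof (cases k rule: times_L3_lines_cases)
    case (1 l i)
    then obtain a b where ab: "p = (a, i)" "q = (b, i)" "a \<in> l" "b \<in> l" "a \<noteq> b"
      using pq by blast
    then have "l = {a, b, a + b}"
      using Q52_line_third[OF 1(2)] by blast
    then have "l \<times> {i} = {(a, i), (b, i), (a + b, i)}"
      by blast
    then show ?thesis
      by (simp add: ab(1,2) 1(1))
  next
    case (2 x)
    then show ?thesis
      using pq by auto
  qed
  show "L3_dist p p = 0" for p
    by (simp add: L3_dist_def quadric_dist_def)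
  show "L3_dist p q \<le> 3" for p q
    by (simp add: L3_dist_def quadric_dist_def)
  \<comment> \<open>If all points were perpendicular, two different lines on a point would violate
    \<open>no_singular_plane\<close>.\<close>
  have "\<exists>x\<in>Q52_points. \<exists>y\<in>Q52_points. polar x y \<noteq> 0"
  proof (rule ccontr)
    assume *: "\<not> ?thesis"
    obtain x where x: "x \<in> Q52_points"
      using sum_of_two_points by blast
    obtain z z' where "z \<in> Q52_points" "z' \<in> Q52_points" "z \<noteq> x" "z' \<noteq> x" "z' \<noteq> z" "z' \<noteq> x + z"
      using two_lines[OF x] by blast
    then show False
      using no_singular_plane[of z' x z] * x by blast
  qed
  then obtain x y where "x \<in> Q52_points" "y \<in> Q52_points" "polar x y \<noteq> 0"
    by blast
  moreover from this have "x \<noteq> y"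
    using polar_self by blast
  ultimately show "\<exists>p\<in>points (times_L3 Q52). \<exists>q\<in>points (times_L3 Q52). L3_dist p q = 3"
    by (intro bexI[of _ "(x, 0)"] bexI[of _ "(y, 1)"])
      (auto simp: points_times_L3 L3_dist_def quadric_dist_def)
qed (rule L3_gate L3_dist_step L3_dist_dense; assumption)+

lemma card_points_times_L3: "card (points (times_L3 Q52)) = 81"
  unfolding points_times_L3 by (simp add: card_cartesian_product card_Q52_points)

text \<open>GF(2)^6 \<times> GF(2)^6 is interleaved into pairs. Layer 0 fills the first entries,
  layer 1 the second and layer 2 both, so every fibre sums to zero.\<close>

definition L3_vec :: "(bit ^ 6) \<times> nat \<Rightarrow> (bit \<times> bit) ^ 6" where
  "L3_vec p = (\<chi> k. (if snd p \<noteq> 1 then fst p $ k else 0, if snd p \<noteq> 0 then fst p $ k else 0))"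

lemma L3_vec_add: "L3_vec (x + y, i) = L3_vec (x, i) + L3_vec (y, i)"
  unfolding vec_eq_iff
proof
  fix k
  show "L3_vec (x + y, i) $ k = (L3_vec (x, i) + L3_vec (y, i)) $ k"
    by (cases "i = 0"; cases "i = 1") (simp_all add: L3_vec_def)
qed

lemma bit_pairs_add_self: "(x :: (bit \<times> bit) ^ 'n) + x = 0"
  by (simp add: vec_eq_iff prod_eq_iff)

lemma L3_vec_line:
  assumes "k \<in> lines (times_L3 Q52)"
  shows "sum L3_vec k = 0"
  using assms
proof (cases k rule: times_L3_lines_cases)
  case (1 l i)
  then obtain x y where l: "l = {x, y, x + y}" "x \<noteq> y" "x + y \<noteq> x" "x + y \<noteq> y"
    using Q52_lines_cases[OF 1(2)] by metis
  then have "k = {(x, i), (y, i), (x + y, i)}"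
    using 1(1) by blast
  then have "sum L3_vec k = L3_vec (x, i) + (L3_vec (y, i) + L3_vec (x + y, i))"
    using l(2-4)[symmetric] by simp
  also have "\<dots> = (L3_vec (x, i) + L3_vec (y, i)) + (L3_vec (x, i) + L3_vec (y, i))"
    by (simp only: L3_vec_add add.assoc)
  also have "\<dots> = 0"
    by (rule bit_pairs_add_self)
  finally show ?thesis .
next
  case (2 x)
  then have "sum L3_vec k = L3_vec (x, 0) + (L3_vec (x, 1) + L3_vec (x, 2))"
    by simp
  also have "\<dots> = 0"
    by (simp add: vec_eq_iff L3_vec_def prod_eq_iff)
  finally show ?thesis .
qed

lemma L3_line_polar:
  assumes "k \<in> lines (times_L3 Q52)" "p \<in> k" "q \<in> k"
  shows "polar (fst p) (fst q) = 0"
  using assms(1)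
proof (cases k rule: times_L3_lines_cases)
  case (1 l i)
  then show ?thesis
    using Q52_line_third(2)[OF 1(2), of "fst p" "fst q"] assms(2,3) polar_self by (cases "fst p = fst q") auto
next
  case (2 x)
  then show ?thesis
    using assms(2,3) polar_self by auto
qed

text \<open>Sums of two points reach every vector within a layer; layers 0 and 1 then supply the two
  halves independently.\<close>

lemma L3_vec_span:
  assumes vec: "\<And>p. p \<in> points (times_L3 Q52) \<Longrightarrow> L3_vec p \<in> T"
    and add: "\<And>x y. x \<in> T \<Longrightarrow> y \<in> T \<Longrightarrow> x + y \<in> T"
  shows "T = UNIV"
proof -
  have L3: "L3_vec (x, i) \<in> T" if "i \<in> {0, 1, 2}" for x i
  proof -
    obtain y z where "y \<in> Q52_points" "z \<in> Q52_points" "x = y + z"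
      using sum_of_two_points by blast
    then show ?thesis
      using add vec that by (simp only: L3_vec_add points_times_L3) blast
  qed
  have "x \<in> T" for x
  proof -
    have "x = L3_vec (\<chi> k. fst (x $ k), 0) + L3_vec (\<chi> k. snd (x $ k), 1)"
      by (simp add: vec_eq_iff L3_vec_def prod_eq_iff)
    then show ?thesis
      using add[OF L3 L3] by (metis insertI1 insertI2)
  qed
  then show ?thesis
    by blast
qed

lemma times_L3_representation:
  "\<exists>(R :: nat monoid) \<psi>. extra_special_plus 6 R \<and> nonabelian_representation (times_L3 Q52) R \<psi>"
proof -
  obtain e :: "bit \<times> ((bit \<times> bit) ^ 6) \<Rightarrow> nat" where e: "inj e"
    using finite_imp_inj_to_nat_seg[OF finite_class.finite_UNIV] by blast
  \<comment> \<open>Together with \<open>swap6\<close> this \<open>c\<close> gives f(p, q') for the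
    polar form f; its diagonal values on the basis vanish, so every factor is dihedral.\<close>
  define c :: "bit \<times> bit \<Rightarrow> bit \<times> bit \<Rightarrow> bit" where "c x y = fst x * snd y" for x y
  interpret coordinate_cocycle c swap6 e
  proof
    show "c (p + p') q = c p q + c p' q" for p p' q
      unfolding c_def by (simp only: fst_add distrib_right)
    show "c p (q + q') = c p q + c p q'" for p q q'
      unfolding c_def by (simp only: snd_add distrib_left)
    have "\<forall>i. swap6 (swap6 i) = i"
      unfolding all_6 by (simp add: swap6_def)
    then show "swap6 (swap6 i) = i" for i
      by blast
  qed (simp_all add: c_def e)
  have "extra_special_plus CARD(6) G"
    by (rule extra_special_plus_G) (simp_all add: c_def)
  then have plus: "extra_special_plus 6 G"
    by simp
  \<comment> \<open>Depending on the layers, \<open>\<beta>\<close> is either the polar form of the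
    underlying vectors or zero.\<close>
  have perp: "\<beta> (L3_vec p) (L3_vec q) = 0" if "polar (fst p) (fst q) = 0" for p q
  proof -
    have "\<beta> (L3_vec p) (L3_vec q) = (if snd p \<noteq> 1 \<and> snd q \<noteq> 0 then polar (fst p) (fst q) else 0)"
      by (auto simp: \<beta>_def c_def L3_vec_def polar_def)
    then show ?thesis
      using that by simp
  qed
  have "nonabelian_representation (times_L3 Q52) G (\<lambda>p. e (0, L3_vec p))"
  proof (rule nonabelian_representationI)
    show "L3_vec p \<noteq> 0 \<and> \<beta> (L3_vec p) (L3_vec p) = 0" if "p \<in> points (times_L3 Q52)" for p
    proof
      have "fst p \<noteq> 0"
        using that unfolding points_times_L3 Q52_points_def by auto
      then obtain k where "fst p $ k \<noteq> 0"
        by (auto simp: vec_eq_iff)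
      then have "L3_vec p $ k \<noteq> 0"
        by (cases "snd p = 1") (auto simp: L3_vec_def zero_prod_def)
      then show "L3_vec p \<noteq> 0"
        by auto
      show "\<beta> (L3_vec p) (L3_vec p) = 0"
        by (rule perp[OF polar_self])
    qed
    show "{x, y, z} \<subseteq> points (times_L3 Q52) \<and> L3_vec x + L3_vec y = L3_vec z \<and>
        \<beta> (L3_vec x) (L3_vec y) = 0"
      if "distinct [x, y, z]" "{x, y, z} \<in> lines (times_L3 Q52)" for x y z
    proof (intro conjI)
      show "{x, y, z} \<subseteq> points (times_L3 Q52)"
        using times_L3_line[OF that(2)] by blast
      have "L3_vec x + (L3_vec y + L3_vec z) = 0"
        using L3_vec_line[OF that(2)] that(1) by simp
      then have "L3_vec x + L3_vec y + L3_vec z = L3_vec z + L3_vec z"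
        by (simp only: add_self add.assoc)
      then show "L3_vec x + L3_vec y = L3_vec z"
        by (simp only: add_right_cancel)
      show "\<beta> (L3_vec x) (L3_vec y) = 0"
        using L3_line_polar[OF that(2), of x y] perp by blast
    qed
    show "T = UNIV" if "\<And>p. p \<in> points (times_L3 Q52) \<Longrightarrow> L3_vec p \<in> T"
      "\<And>x y. x \<in> T \<Longrightarrow> y \<in> T \<Longrightarrow> x + y \<in> T" for T
      using that by (rule L3_vec_span)
  qed
  with plus show ?thesis
    by blast
qed

theorem theorem1p1:
  shows "(slim_dense_near_hexagon (times_L3 Q52) \<and> card (points (times_L3 Q52)) = 81 \<and>
           (\<exists>(R :: nat monoid) \<psi>. extra_special_plus 6 R \<and>
              nonabelian_representation (times_L3 Q52) R \<psi>)) \<and>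
         (slim_dense_near_hexagon Q52_glued_Q52 \<and> card (points Q52_glued_Q52) = 243 \<and>
           (\<exists>(R :: nat monoid) \<psi>. extra_special_minus 9 R \<and>
              nonabelian_representation Q52_glued_Q52 R \<psi>))"
  using slim_dense_near_hexagon_times_L3 card_points_times_L3 times_L3_representation
    slim_dense_near_hexagon_glued card_points_glued glued_representation by blast

end
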